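(* The equational class of distributive lattices has unitary exact unification type. Each of the equational classes of bounded distributive lattices, idempotent semigroups (bands), De Morgan algebras, and Kleene algebras has finitary exact unification type.
   Context: Let $\langle P,\le\rangle$ be a preordered set. A subset $M\subseteq P$ is complete if for every $x\in P$ there is $y\in M$ with $x\le y$. A complete set $M$ is a $\mu$-set if $x\not\le y$ and $y\not\le x$ for all distinct $x,y\in M$. All $\mu$-sets of a given preordered set have the same cardinality. The preordered set has type $0$ (nullary) if it has no $\mu$-set, type $\infty$ (infinitary) if it has an infinite $\mu$-set, type $\omega$ (finitary) if it has a finite $\mu$-set of cardinality greater than $1$, and type $1$ (unitary) if it has a $\mu$-set of cardinality $1$. Types are ordered by $1<\omega<\infty<0$. Let $\mathcal{V}$ be an equational class (variety) of algebras in a language $\mathcal{L}$. For a set of variables $X\subseteq\omega$, $\mathbf{Fm}_{\mathcal{L}}(X)$ is the absolutely free (term) algebra over $X$, $\mathbf{F}_{\mathcal{V}}(X)$ is the free algebra of $\mathcal{V}$ over $X$, and $h_{\mathcal{V}}\colon \mathbf{Fm}_{\mathcal{L}}(X)\to\mathbf{F}_{\mathcal{V}}(X)$ is the canonical homomorphism fixing the elements of $X$. A substitution is a homomorphism $\sigma\colon\mathbf{Fm}_{\mathcal{L}}(X)\to\mathbf{Fm}_{\mathcal{L}}(\omega)$; it is a $\mathcal{V}$-unifier over $X$ of a set $\Sigma$ of $\mathcal{L}$-identities with variables in $X$ if $\mathcal{V}\models\sigma(\varphi)\approx\sigma(\psi)$ for all $\varphi\approx\psi$ in $\Sigma$. $\Sigma$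 is $\mathcal{V}$-unifiable if it has a $\mathcal{V}$-unifier. The kernel of a homomorphism $h\colon\mathbf{A}\to\mathbf{B}$ is $\ker(h)=\{(a,b)\in A^2\mid h(a)=h(b)\}$. Write $\sigma_2\sqsubseteq_{\mathcal{V}}\sigma_1$ iff $\ker(h_{\mathcal{V}}\circ\sigma_1)\subseteq\ker(h_{\mathcal{V}}\circ\sigma_2)$. For a finite set $\Sigma$ of identities, $\mathsf{E}_{\mathcal{V}}(\Sigma)$ is the set of $\mathcal{V}$-unifiers of $\Sigma$ over the set $\mathrm{Var}(\Sigma)$ of variables occurring in $\Sigma$, preordered by $\sqsubseteq_{\mathcal{V}}$. The exact unification type of $\mathcal{V}$ is the maximal value of $\mathrm{type}(\mathsf{E}_{\mathcal{V}}(\Sigma))$ over all $\mathcal{V}$-unifiable finite sets $\Sigma$; it is called unitary if it is $1$ and finitary if it is $\omega$. Languages: distributive lattices are in the language $\{\wedge,\vee\}$ (no constants); bounded distributive lattices are in the language $\{\wedge,\vee,0,1\}$; a De Morgan algebra is a bounded distributive lattice with a unary operation $\neg$ satisfying $\neg\neg x\approx x$ and $\neg(x\wedge y)\approx\neg x\vee\neg y$; a Kleene algebra is a De Morgan algebra satisfying $x\wedge\neg x\le y\vee\neg y$; an idempotent semigroup is a semigroup satisfying $xx\approx x$. *)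

theory Defs
  imports Main "HOL-Library.FuncSet"
begin

subsection \<open>Types of preordered sets\<close>

datatype unif_type = Unitary | Finitary | Infinitary | Nullary

primrec type_rank :: "unif_type \<Rightarrow> nat" where
  "type_rank Unitary = 0"
| "type_rank Finitary = 1"
| "type_rank Infinitary = 2"
| "type_rank Nullary = 3"

instantiation unif_type :: linorder
begin

definition less_eq_unif_type :: "unif_type \<Rightarrow> unif_type \<Rightarrow> bool" where
  "s \<le> t \<longleftrightarrow> type_rank s \<le> type_rank t"

definition less_unif_type :: "unif_type \<Rightarrow> unif_type \<Rightarrow> bool" where
  "s < t \<longleftrightarrow> type_rank s < type_rank t"

instance
proof
  fix s t :: unif_type
  assume "s \<le> t" and "t \<le> s"
  then show "s = t"
    by (cases s; cases t) (simp_all add: less_eq_unif_type_def)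
qed (auto simp: less_eq_unif_type_def less_unif_type_def)

end

definition complete_set :: "'b set \<Rightarrow> ('b \<Rightarrow> 'b \<Rightarrow> bool) \<Rightarrow> 'b set \<Rightarrow> bool" where
  "complete_set P le M \<longleftrightarrow> M \<subseteq> P \<and> (\<forall>x\<in>P. \<exists>y\<in>M. le x y)"

definition mu_set :: "'b set \<Rightarrow> ('b \<Rightarrow> 'b \<Rightarrow> bool) \<Rightarrow> 'b set \<Rightarrow> bool" where
  "mu_set P le M \<longleftrightarrow>
     complete_set P le M \<and> (\<forall>x\<in>M. \<forall>y\<in>M. x \<noteq> y \<longrightarrow> \<not> le x y \<and> \<not> le y x)"

text \<open>All \<mu>-sets of a preordered set have the same cardinality, so the order of the
  cases is immaterial. The value \<^const>\<open>undefined\<close> is reached only for the empty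
  preordered set, whose only \<mu>-set is empty and to which no type is assigned.\<close>

definition preorder_type :: "'b set \<Rightarrow> ('b \<Rightarrow> 'b \<Rightarrow> bool) \<Rightarrow> unif_type" where
  "preorder_type P le =
     (if \<not> (\<exists>M. mu_set P le M) then Nullary
      else if \<exists>M. mu_set P le M \<and> infinite M then Infinitary
      else if \<exists>M. mu_set P le M \<and> finite M \<and> card M > 1 then Finitary
      else if \<exists>M. mu_set P le M \<and> card M = 1 then Unitary
      else undefined)"


subsection \<open>Algebras, terms and identities\<close>

text \<open>A language is a type of operation symbols together with their arities.\<close>

class language =
  fixes arity :: "'a \<Rightarrow> nat"

text \<open>The operations are relevant only on lists over the carrier of the right length.
  The carrier may be empty: this is needed for term algebras over the empty set of variables
  in a language without constants.\<close>

record ('f, 'a) alg =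
  carr :: "'a set"
  oper :: "'f \<Rightarrow> 'a list \<Rightarrow> 'a"

definition is_alg :: "('f::language, 'a) alg \<Rightarrow> bool" where
  "is_alg A \<longleftrightarrow> (\<forall>f. \<forall>as\<in>lists (carr A). length as = arity f \<longrightarrow> oper A f as \<in> carr A)"

definition homs :: "('f::language, 'a) alg \<Rightarrow> ('f, 'b) alg \<Rightarrow> ('a \<Rightarrow> 'b) set" where
  "homs A B = {h \<in> carr A \<rightarrow>\<^sub>E carr B.
     \<forall>f. \<forall>as\<in>lists (carr A). length as = arity f \<longrightarrow> h (oper A f as) = oper B f (map h as)}"

definition ker :: "('f, 'a) alg \<Rightarrow> ('a \<Rightarrow> 'b) \<Rightarrow> ('a \<times> 'a) set" where
  "ker A h = {(a, b). a \<in> carr A \<and> b \<in> carr A \<and> h a = h b}"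

text \<open>Raw terms, in which arities need not be respected; they are respected by the elements
  of the term algebras \<open>Fm X\<close>.\<close>

datatype 'f trm = Var nat | App 'f "'f trm list"

fun vars :: "'f trm \<Rightarrow> nat set" where
  "vars (Var x) = {x}"
| "vars (App f ts) = (\<Union>t\<in>set ts. vars t)"

fun wf_trm :: "'f::language trm \<Rightarrow> bool" where
  "wf_trm (Var x) \<longleftrightarrow> True"
| "wf_trm (App f ts) \<longleftrightarrow> length ts = arity f \<and> (\<forall>t\<in>set ts. wf_trm t)"

definition Fm :: "nat set \<Rightarrow> ('f::language, 'f trm) alg" where
  "Fm X = \<lparr>carr = {t. wf_trm t \<and> vars t \<subseteq> X}, oper = App\<rparr>"

primrec eval :: "('f, 'a) alg \<Rightarrow> (nat \<Rightarrow> 'a) \<Rightarrow> 'f trm \<Rightarrow> 'a" where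
  "eval A v (Var x) = v x"
| "eval A v (App f ts) = oper A f (map (eval A v) ts)"

type_synonym 'f identity = "'f trm \<times> 'f trm"

definition satisfies :: "('f, 'a) alg \<Rightarrow> 'f identity \<Rightarrow> bool" where
  "satisfies A e \<longleftrightarrow> (\<forall>v. range v \<subseteq> carr A \<longrightarrow> eval A v (fst e) = eval A v (snd e))"

definition equational_class :: "'f::language identity set \<Rightarrow> ('f, 'a) alg set" where
  "equational_class E = {A. is_alg A \<and> carr A \<noteq> {} \<and> (\<forall>e\<in>E. satisfies A e)}"

definition valid :: "('f, 'a) alg set \<Rightarrow> 'f identity \<Rightarrow> bool" where
  "valid V e \<longleftrightarrow> (\<forall>A\<in>V. satisfies A e)"


subsection \<open>Free algebras\<close>

text \<open>The free algebra over \<open>X\<close> is the quotient of the term algebra over \<open>X\<close> by the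
  congruence of all identities valid in the class, and \<open>canon_hom\<close> is the quotient map.\<close>

definition free_cong :: "('f::language, 'a) alg set \<Rightarrow> nat set \<Rightarrow> ('f trm \<times> 'f trm) set" where
  "free_cong V X = {(s, t). s \<in> carr (Fm X) \<and> t \<in> carr (Fm X) \<and> valid V (s, t)}"

definition free_alg :: "('f::language, 'a) alg set \<Rightarrow> nat set \<Rightarrow> ('f, 'f trm set) alg" where
  "free_alg V X =
     \<lparr>carr = carr (Fm X) // free_cong V X,
      oper = (\<lambda>f Cs. free_cong V X `` {App f (map (\<lambda>C. SOME t. t \<in> C) Cs)})\<rparr>"

definition canon_hom :: "('f::language, 'a) alg set \<Rightarrow> nat set \<Rightarrow> 'f trm \<Rightarrow> 'f trm set" where
  "canon_hom V X = (\<lambda>t\<in>carr (Fm X). free_cong V X `` {t})"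

lemma equiv_free_cong: "equiv (carr (Fm X)) (free_cong V X)"
  unfolding equiv_def refl_on_def sym_def trans_def
  by (auto simp: free_cong_def valid_def satisfies_def)

lemma canon_hom_eq_iff:
  assumes "s \<in> carr (Fm X)" and "t \<in> carr (Fm X)"
  shows "canon_hom V X s = canon_hom V X t \<longleftrightarrow> valid V (s, t)"
  using assms eq_equiv_class_iff[OF equiv_free_cong assms, of V]
  by (auto simp: canon_hom_def free_cong_def)

lemma canon_hom_mem:
  fixes V :: "('f::language, 'b) alg set"
  shows "canon_hom V X \<in> homs (Fm X) (free_alg V X)"
proof -
  have *: "canon_hom V X (App f ts) = oper (free_alg V X) f (map (canon_hom V X) ts)"
    if ts: "ts \<in> lists (carr (Fm X))" and len: "length ts = arity f" for f and ts :: "'f trm list"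
  proof -
    define r where "r = (\<lambda>t. SOME u. u \<in> canon_hom V X t)"
    have r: "(t, r t) \<in> free_cong V X" if "t \<in> set ts" for t
    proof -
      from that ts have t: "t \<in> carr (Fm X)" by auto
      then have "t \<in> canon_hom V X t"
        using equiv_class_self[OF equiv_free_cong t] by (simp add: canon_hom_def)
      then have "r t \<in> canon_hom V X t" unfolding r_def by (rule someI)
      with t show ?thesis by (simp add: canon_hom_def)
    qed
    have mem: "App f ts \<in> carr (Fm X)" "App f (map r ts) \<in> carr (Fm X)"
      using ts len r by (fastforce simp: Fm_def free_cong_def)+
    have "valid V (App f ts, App f (map r ts))"
      unfolding valid_def satisfies_def
    proof (intro ballI allI impI)
      fix A and v :: "nat \<Rightarrow> 'b"
      assume "A \<in> V" and "range v \<subseteq> carr A"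
      with r have "eval A v t = eval A v (r t)" if "t \<in> set ts" for t
        using that by (fastforce simp: free_cong_def valid_def satisfies_def)
      then show "eval A v (fst (App f ts, App f (map r ts))) =
          eval A v (snd (App f ts, App f (map r ts)))"
        by (simp add: comp_def cong: map_cong)
    qed
    then have "canon_hom V X (App f ts) = canon_hom V X (App f (map r ts))"
      using canon_hom_eq_iff mem by blast
    then show ?thesis
      using mem by (simp add: canon_hom_def free_alg_def r_def comp_def)
  qed
  have "canon_hom V X \<in> carr (Fm X) \<rightarrow>\<^sub>E carr (free_alg V X)"
    by (auto simp: canon_hom_def free_alg_def intro: quotientI)
  moreover have "oper (Fm X) = (App :: 'f \<Rightarrow> _)" by (simp add: Fm_def)
  ultimately show ?thesis
    using * by (simp add: homs_def)
qed


subsection \<open>Unifiers and exact unification type\<close>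

definition substs :: "nat set \<Rightarrow> ('f::language trm \<Rightarrow> 'f trm) set" where
  "substs X = homs (Fm X) (Fm UNIV)"

definition identity_vars :: "'f identity set \<Rightarrow> nat set" where
  "identity_vars S = (\<Union>(s, t)\<in>S. vars s \<union> vars t)"

definition unifiers ::
    "('f::language, 'a) alg set \<Rightarrow> nat set \<Rightarrow> 'f identity set \<Rightarrow> ('f trm \<Rightarrow> 'f trm) set" where
  "unifiers V X S = {\<sigma> \<in> substs X. \<forall>(s, t)\<in>S. valid V (\<sigma> s, \<sigma> t)}"

text \<open>\<open>exact_le V X \<sigma>\<^sub>2 \<sigma>\<^sub>1\<close> means that \<open>\<sigma>\<^sub>2\<close> is below \<open>\<sigma>\<^sub>1\<close>, for substitutions over \<open>X\<close>.\<close>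

definition exact_le ::
    "('f::language, 'a) alg set \<Rightarrow> nat set \<Rightarrow> ('f trm \<Rightarrow> 'f trm) \<Rightarrow> ('f trm \<Rightarrow> 'f trm) \<Rightarrow> bool" where
  "exact_le V X \<sigma>\<^sub>2 \<sigma>\<^sub>1 \<longleftrightarrow>
     ker (Fm X) (canon_hom V UNIV \<circ> \<sigma>\<^sub>1) \<subseteq> ker (Fm X) (canon_hom V UNIV \<circ> \<sigma>\<^sub>2)"

definition exact_unifiers_type ::
    "('f::language, 'a) alg set \<Rightarrow> 'f identity set \<Rightarrow> unif_type" where
  "exact_unifiers_type V S =
     preorder_type (unifiers V (identity_vars S) S) (exact_le V (identity_vars S))"

definition unifiable :: "('f::language, 'a) alg set \<Rightarrow> 'f identity set \<Rightarrow> bool" where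
  "unifiable V S \<longleftrightarrow> unifiers V (identity_vars S) S \<noteq> {}"

definition exact_unification_type :: "('f::language, 'a) alg set \<Rightarrow> unif_type" where
  "exact_unification_type V =
     Max {exact_unifiers_type V S | S.
       S \<subseteq> carr (Fm UNIV) \<times> carr (Fm UNIV) \<and> finite S \<and> unifiable V S}"


subsection \<open>The equational classes\<close>

definition distributive_lattice_ids :: "'f \<Rightarrow> 'f \<Rightarrow> 'f identity set" where
  "distributive_lattice_ids meet join =
     (let x = Var 0; y = Var 1; z = Var 2;
          m = (\<lambda>s t. App meet [s, t]); j = (\<lambda>s t. App join [s, t])
      in {(m x y, m y x), (j x y, j y x),
          (m x (m y z), m (m x y) z), (j x (j y z), j (j x y) z),
          (m x (j x y), x), (j x (m x y), x),
          (m x (j y z), j (m x y) (m x z))})"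

definition bound_ids :: "'f \<Rightarrow> 'f \<Rightarrow> 'f \<Rightarrow> 'f \<Rightarrow> 'f identity set" where
  "bound_ids meet join zero one =
     (let x = Var 0
      in {(App meet [x, App zero []], App zero []), (App join [x, App one []], App one [])})"

definition de_morgan_ids :: "'f \<Rightarrow> 'f \<Rightarrow> 'f \<Rightarrow> 'f identity set" where
  "de_morgan_ids meet join neg =
     (let x = Var 0; y = Var 1; n = (\<lambda>t. App neg [t])
      in {(n (n x), x), (n (App meet [x, y]), App join [n x, n y])})"

text \<open>The inequality \<open>s \<le> t\<close> is the identity \<open>s \<and> t \<approx> s\<close>.\<close>

definition kleene_ids :: "'f \<Rightarrow> 'f \<Rightarrow> 'f \<Rightarrow> 'f identity set" where
  "kleene_ids meet join neg =
     (let x = Var 0; y = Var 1;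
          s = App meet [x, App neg [x]]; t = App join [y, App neg [y]]
      in {(App meet [s, t], s)})"

datatype lat_sym = LMeet | LJoin

instantiation lat_sym :: language
begin
primrec arity_lat_sym :: "lat_sym \<Rightarrow> nat" where
  "arity LMeet = 2"
| "arity LJoin = 2"
instance ..
end

datatype blat_sym = BMeet | BJoin | BZero | BOne

instantiation blat_sym :: language
begin
primrec arity_blat_sym :: "blat_sym \<Rightarrow> nat" where
  "arity BMeet = 2"
| "arity BJoin = 2"
| "arity BZero = 0"
| "arity BOne = 0"
instance ..
end

datatype dm_sym = DMeet | DJoin | DZero | DOne | DNeg

instantiation dm_sym :: language
begin
primrec arity_dm_sym :: "dm_sym \<Rightarrow> nat" where
  "arity DMeet = 2"
| "arity DJoin = 2"
| "arity DZero = 0"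
| "arity DOne = 0"
| "arity DNeg = 1"
instance ..
end

datatype sg_sym = SMult

instantiation sg_sym :: language
begin
primrec arity_sg_sym :: "sg_sym \<Rightarrow> nat" where
  "arity SMult = 2"
instance ..
end

definition distributive_lattices :: "(lat_sym, 'a) alg set" where
  "distributive_lattices = equational_class (distributive_lattice_ids LMeet LJoin)"

definition bounded_distributive_lattices :: "(blat_sym, 'a) alg set" where
  "bounded_distributive_lattices =
     equational_class (distributive_lattice_ids BMeet BJoin \<union> bound_ids BMeet BJoin BZero BOne)"

definition de_morgan_algebras :: "(dm_sym, 'a) alg set" where
  "de_morgan_algebras =
     equational_class (distributive_lattice_ids DMeet DJoin \<union> bound_ids DMeet DJoin DZero DOne \<union>
       de_morgan_ids DMeet DJoin DNeg)"

definition kleene_algebras :: "(dm_sym, 'a) alg set" where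
  "kleene_algebras =
     equational_class (distributive_lattice_ids DMeet DJoin \<union> bound_ids DMeet DJoin DZero DOne \<union>
       de_morgan_ids DMeet DJoin DNeg \<union> kleene_ids DMeet DJoin DNeg)"

definition idempotent_semigroups :: "(sg_sym, 'a) alg set" where
  "idempotent_semigroups =
     (let x = Var 0; y = Var 1; z = Var 2; m = (\<lambda>s t. App SMult [s, t])
      in equational_class {(m x (m y z), m (m x y) z), (m x x, x)})"

end

theory Submission
  imports Defs "HOL-Library.Countable"
begin

text \<open>
  The exact preorder compares unifiers only through their kernels. All five varieties are locally finite,
  so over finitely many variables only finitely many kernels occur, and a nonempty preorder with finitely
  many kernels has a finite \<open>\<mu>\<close>-set. Hence every exact type is at most finitary, and it is unitary exactly
  if there is a greatest unifier (\<open>preorder_type_eq\<close> in the locale \<open>kernel_preorder\<close>).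

  Distributive lattices, bounded distributive lattices, De Morgan algebras and Kleene algebras are
  governed by one finite algebra each, with two, two, four and three elements: prime filters separate
  points, so an identity is valid as soon as it holds there (\<open>valid_iff_satisfies\<close>). This
  also gives local finiteness. For bands, local finiteness is the theorem of Green and Rees
  (\<open>finite_band_words\<close>), obtained from the identity \<open>w u w \<approx> w\<close> for words with the letters of \<open>u\<close> among
  those of \<open>w\<close> (\<open>band_eq_absorb\<close>).

  For distributive lattices without constants, any two unifiers are glued, by means of two fresh
  variables, to a unifier above both (\<open>exact_type_distributive_lattices\<close>). A finite directed preorder has
  a greatest element, so the type is unitary.

  For the other varieties some set of identities implies, on free algebras, a disjunction of two
  identities neither of which follows by itself; this excludes a greatest unifier (\<open>exact_unification_type_finitaryI\<close>). In
  the presence of constants, \<open>x \<or> y \<approx> 1\<close> forces \<open>x \<approx> 1\<close> or \<open>y \<approx> 1\<close>, because a single valuation, least in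
  the truth order or in the information order, decides whether a term equals \<open>1\<close>. In bands,
  \<open>x y \<approx> y x\<close> forces \<open>x y \<approx> y\<close> or \<open>y x \<approx> x\<close>, because the orders of first occurrences of variables in
  commuting terms are comparable.
\<close>

section \<open>Preorders given by finitely many kernels\<close>

text \<open>The type of a preorder that compares elements only through kernels, finitely many of which occur, is
  decided by the existence of a greatest element: choosing one representative for each minimal kernel
  gives a \<open>\<mu>\<close>-set, and distinct elements of a \<open>\<mu>\<close>-set have distinct kernels.\<close>

locale kernel_preorder =
  fixes P :: "'b set" and le :: "'b \<Rightarrow> 'b \<Rightarrow> bool" and K :: "'b \<Rightarrow> 'c set"
  assumes le_iff: "\<And>x y. x \<in> P \<Longrightarrow> y \<in> P \<Longrightarrow> le x y \<longleftrightarrow> K y \<subseteq> K x"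
    and nonempty: "P \<noteq> {}"
    and finite_kernels: "finite (K ` P)"
begin

lemma mu_set_exists: "\<exists>M. mu_set P le M"
proof -
  define N where "N = {k \<in> K ` P. \<forall>l \<in> K ` P. l \<subseteq> k \<longrightarrow> l = k}"
  have inv: "inv_into P K k \<in> P" "K (inv_into P K k) = k" if "k \<in> N" for k
    using that by (auto simp: N_def inv_into_into f_inv_into_f)
  have "\<exists>y \<in> inv_into P K ` N. le x y" if "x \<in> P" for x
  proof -
    obtain k where k: "k \<in> K ` P" "k \<subseteq> K x" "\<forall>l \<in> K ` P. l \<subseteq> k \<longrightarrow> k = l"
      using finite_has_minimal2[OF finite_kernels imageI[OF \<open>x \<in> P\<close>]] by metis
    then have "k \<in> N" by (auto simp: N_def)
    then have "le x (inv_into P K k)" using inv[of k] k(2) that le_iff by simp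
    then show ?thesis using \<open>k \<in> N\<close> by blast
  qed
  moreover have "\<not> le x y" if "x \<in> inv_into P K ` N" "y \<in> inv_into P K ` N" "x \<noteq> y" for x y
  proof -
    obtain k l where kl: "k \<in> N" "l \<in> N" "x = inv_into P K k" "y = inv_into P K l"
      using \<open>x \<in> _ ` N\<close> \<open>y \<in> _ ` N\<close> by blast
    then have "k \<noteq> l" using that by auto
    moreover have "k \<in> K ` P" "l \<in> K ` P" using kl by (auto simp: N_def)
    ultimately have "\<not> l \<subseteq> k" using kl by (auto simp: N_def)
    then show ?thesis using kl inv le_iff by simp
  qed
  ultimately have "mu_set P le (inv_into P K ` N)"
    using inv by (auto simp: mu_set_def complete_set_def)
  then show ?thesis by blast
qed

lemma mu_set_finite:
  assumes "mu_set P le M"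
  shows "finite M" and "card M \<ge> 1"
proof -
  have M: "M \<subseteq> P" using assms by (auto simp: mu_set_def complete_set_def)
  have "inj_on K M"
  proof (rule inj_onI)
    fix x y assume "x \<in> M" "y \<in> M" "K x = K y"
    then show "x = y" using assms M le_iff[of x y] by (auto simp: mu_set_def)
  qed
  then show "finite M"
    using finite_kernels M by (meson finite_imageD finite_subset image_mono)
  moreover have "M \<noteq> {}" using assms nonempty by (auto simp: mu_set_def complete_set_def)
  ultimately show "card M \<ge> 1" by (simp add: Suc_le_eq card_gt_0_iff)
qed

lemma mu_set_unitary_iff:
  assumes M: "mu_set P le M"
  shows "card M = 1 \<longleftrightarrow> (\<exists>g\<in>P. \<forall>x\<in>P. le x g)"
proof
  assume "card M = 1"
  then obtain g where "M = {g}" by (auto simp: card_1_singleton_iff)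
  then show "\<exists>g\<in>P. \<forall>x\<in>P. le x g" using M by (auto simp: mu_set_def complete_set_def)
next
  assume "\<exists>g\<in>P. \<forall>x\<in>P. le x g"
  then obtain g where g: "g \<in> P" "\<And>x. x \<in> P \<Longrightarrow> le x g" by blast
  have sub: "M \<subseteq> P" using M by (auto simp: mu_set_def complete_set_def)
  obtain m where m: "m \<in> M" "le g m" using M g(1) by (auto simp: mu_set_def complete_set_def)
  have "x = m" if x: "x \<in> M" for x
  proof -
    have "le x g" using g x sub by auto
    then have "le x m" using m le_iff g x sub by (meson order_trans subsetD)
    then show ?thesis using M x m by (auto simp: mu_set_def)
  qed
  then have "M = {m}" using m(1) by blast
  then show "card M = 1" by simp
qed

lemma preorder_type_eq:
  "preorder_type P le = (if \<exists>g\<in>P. \<forall>x\<in>P. le x g then Unitary else Finitary)"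
proof -
  obtain M where M: "mu_set P le M" using mu_set_exists by blast
  have fin: "finite N" "card N \<ge> 1" if "mu_set P le N" for N
    using mu_set_finite that by blast+
  have un: "card N = 1 \<longleftrightarrow> (\<exists>g\<in>P. \<forall>x\<in>P. le x g)" if "mu_set P le N" for N
    using mu_set_unitary_iff that .
  have ex: "\<exists>M. mu_set P le M" and no_inf: "\<not> (\<exists>N. mu_set P le N \<and> infinite N)"
    using M fin(1) by blast+
  show ?thesis
  proof (cases "\<exists>g\<in>P. \<forall>x\<in>P. le x g")
    case True
    then have card: "card N = 1" if "mu_set P le N" for N using un that by blast
    then have "\<not> (\<exists>N. mu_set P le N \<and> finite N \<and> card N > 1)" by fastforce
    moreover have "\<exists>N. mu_set P le N \<and> card N = 1" using card M by blast
    ultimately show ?thesis unfolding preorder_type_def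
      by (simp only: ex no_inf True if_True if_False not_True_eq_False)
  next
    case False
    then have "card M \<noteq> 1" using un[OF M] by blast
    then have "card M > 1" using fin(2)[OF M] by linarith
    then have "\<exists>N. mu_set P le N \<and> finite N \<and> card N > 1" using M fin(1) by blast
    then show ?thesis unfolding preorder_type_def
      by (simp only: ex no_inf False if_True if_False not_True_eq_False)
  qed
qed

text \<open>In a finite directed preorder a maximal element is greatest.\<close>

lemma directed_unitary:
  assumes "\<And>x y. x \<in> P \<Longrightarrow> y \<in> P \<Longrightarrow> \<exists>z\<in>P. le x z \<and> le y z"
  shows "preorder_type P le = Unitary"
proof -
  obtain k where k: "k \<in> K ` P" "\<forall>l \<in> K ` P. l \<subseteq> k \<longrightarrow> k = l"
    using finite_has_minimal[OF finite_kernels] nonempty by blast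
  then obtain g where g: "g \<in> P" "k = K g" by auto
  have "le x g" if x: "x \<in> P" for x
  proof -
    obtain z where "z \<in> P" "le x z" "le g z" using assms x g by blast
    then have "K z = K g" using k g le_iff by auto
    then show ?thesis using \<open>le x z\<close> \<open>z \<in> P\<close> x g le_iff by auto
  qed
  then show ?thesis using preorder_type_eq g by auto
qed

end

section \<open>Terms, substitutions and homomorphisms\<close>

lemma finite_vars: "finite (vars t)"
  by (induction t) auto

text \<open>Evaluation preserves every relation that the operations preserve; taken as the graph of a
  homomorphism, a subalgebra, an order or an automorphism, the relation yields the preservation facts
  about evaluation that follow.\<close>

lemma eval_rel:
  assumes "\<And>f as bs. length as = arity f \<Longrightarrow> list_all2 R as bs \<Longrightarrow> R (oper A f as) (oper B f bs)"
    and "wf_trm t" and "\<And>x. x \<in> vars t \<Longrightarrow> R (v x) (w x)"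
  shows "R (eval A v t) (eval B w t)"
  using assms(2,3)
proof (induction t)
  case (App f ts)
  have "list_all2 R (map (eval A v) ts) (map (eval B w) ts)"
    using App by (auto simp: list.rel_map intro!: list.rel_refl_strong)
  then show ?case using App.prems assms(1) by simp
qed simp

lemma eval_cong:
  assumes "\<And>x. x \<in> vars t \<Longrightarrow> v x = w x"
  shows "eval A v t = eval A w t"
  using assms
proof (induction t)
  case (App f ts)
  then have "map (eval A v) ts = map (eval A w) ts" by auto
  then show ?case by (simp only: eval.simps)
qed simp

lemma list_all2_in_carr: "list_all2 (\<lambda>a b. a \<in> S) as bs \<Longrightarrow> as \<in> lists S"
  by (auto simp: list_all2_conv_all_nth in_set_conv_nth in_lists_conv_set)

lemma eval_closed:
  fixes A :: "('f::language, 'a) alg"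
  assumes "is_alg A" and "wf_trm t" and "\<And>x. x \<in> vars t \<Longrightarrow> v x \<in> carr A"
  shows "eval A v t \<in> carr A"
proof -
  have "(\<lambda>a b. a \<in> carr A) (eval A v t) (eval A v t)"
  proof (rule eval_rel[where R = "\<lambda>a b. a \<in> carr A"])
    fix f :: 'f and as and bs :: "'a list"
    assume "length as = arity f" "list_all2 (\<lambda>a b. a \<in> carr A) as bs"
    then show "oper A f as \<in> carr A"
      using assms(1) by (auto simp: is_alg_def list_all2_in_carr)
  qed (use assms in auto)
  then show ?thesis .
qed

lemma eval_hom:
  fixes A :: "('f::language, 'a) alg" and B :: "('f, 'b) alg"
  assumes "is_alg A" and h: "h \<in> homs A B" and "wf_trm t" and "\<And>x. x \<in> vars t \<Longrightarrow> v x \<in> carr A"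
  shows "h (eval A v t) = eval B (h \<circ> v) t"
proof -
  let ?R = "\<lambda>a b. a \<in> carr A \<and> b = h a"
  have "?R (eval A v t) (eval B (h \<circ> v) t)"
  proof (rule eval_rel[where R = ?R])
    fix f :: 'f and as bs
    assume len: "length as = arity f" and rel: "list_all2 ?R as bs"
    then have "as \<in> lists (carr A)" "bs = map h as"
      by (auto simp: list_all2_conv_all_nth in_set_conv_nth in_lists_conv_set intro: nth_equalityI)
    then show "?R (oper A f as) (oper B f bs)"
      using h assms(1) len by (auto simp: homs_def is_alg_def)
  qed (use assms in auto)
  then show ?thesis by simp
qed

lemma carr_Fm [simp]: "t \<in> carr (Fm X) \<longleftrightarrow> wf_trm t \<and> vars t \<subseteq> X"
  by (simp add: Fm_def)

lemma oper_Fm [simp]: "oper (Fm X) = App"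
  by (simp add: Fm_def)

lemma subst_App:
  assumes "\<sigma> \<in> substs X" and "App f ts \<in> carr (Fm X)"
  shows "\<sigma> (App f ts) = App f (map \<sigma> ts)"
proof -
  have "ts \<in> lists (carr (Fm X))" "length ts = arity f"
    using assms(2) by (auto simp: in_lists_conv_set)
  then show ?thesis using assms(1) by (simp add: substs_def homs_def del: carr_Fm)
qed

lemma subst_closed:
  assumes "\<sigma> \<in> substs X" and "t \<in> carr (Fm X)"
  shows "wf_trm (\<sigma> t)"
  using assms by (auto simp: substs_def homs_def Pi_iff PiE_iff)

lemma eval_subst:
  assumes "\<sigma> \<in> substs X" and "t \<in> carr (Fm X)"
    and "\<And>x. x \<in> X \<Longrightarrow> w x = eval A v (\<sigma> (Var x))"
  shows "eval A v (\<sigma> t) = eval A w t"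
  using assms(2)
proof (induction t)
  case (App f ts)
  have "map (eval A v \<circ> \<sigma>) ts = map (eval A w) ts" using App by auto
  then show ?case using subst_App[OF assms(1) App.prems] by (simp del: map_eq_conv)
qed (use assms in auto)

definition subst_of :: "nat set \<Rightarrow> (nat \<Rightarrow> 'f::language trm) \<Rightarrow> 'f trm \<Rightarrow> 'f trm" where
  "subst_of X g = restrict (eval (Fm UNIV) g) (carr (Fm X))"

lemma subst_of_substs:
  assumes "\<And>x. x \<in> X \<Longrightarrow> wf_trm (g x)"
  shows "subst_of X g \<in> substs X"
proof -
  have alg: "is_alg (Fm UNIV :: ('a, 'a trm) alg)" "is_alg (Fm X :: ('a, 'a trm) alg)"
    by (fastforce simp: is_alg_def in_lists_conv_set)+
  have "eval (Fm UNIV) g t \<in> carr (Fm UNIV)" if "t \<in> carr (Fm X)" for t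
    by (rule eval_closed[OF alg(1)]) (use that assms in auto)
  moreover have "App f ts \<in> carr (Fm X)" if "ts \<in> lists (carr (Fm X))" "length ts = arity f" for f :: 'a and ts
    using that by (auto simp: in_lists_conv_set)
  moreover have "map (restrict (eval (Fm UNIV) g) (carr (Fm X))) ts = map (eval (Fm UNIV) g) ts"
    if "ts \<in> lists (carr (Fm X))" for ts
    using that by (auto simp: in_lists_conv_set)
  ultimately show ?thesis
    by (auto simp: substs_def subst_of_def homs_def simp del: carr_Fm)
qed

lemma subst_of_Var [simp]: "x \<in> X \<Longrightarrow> subst_of X g (Var x) = g x"
  by (simp add: subst_of_def)

section \<open>Locally finite varieties\<close>

lemma validD:
  assumes "valid V (s, t)" and "A \<in> V" and "range v \<subseteq> carr A"
  shows "eval A v s = eval A v t"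
  using assms by (auto simp: valid_def satisfies_def)

lemma valid_sym: "valid V (s, t) \<Longrightarrow> valid V (t, s)"
  by (auto simp: valid_def satisfies_def)

text \<open>The substitution is composed with a valuation into a given algebra. Outside \<open>X\<close> the substitution
  is \<^const>\<open>undefined\<close>, so the composite falls back on the valuation there in order to stay in the
  carrier.\<close>

lemma valid_subst:
  fixes V :: "('f::language, 'a) alg set"
  assumes V: "\<And>A. A \<in> V \<Longrightarrow> is_alg A" and \<sigma>: "\<sigma> \<in> substs X"
    and st: "s \<in> carr (Fm X)" "t \<in> carr (Fm X)" and val: "valid V (s, t)"
  shows "valid V (\<sigma> s, \<sigma> t)"
  unfolding valid_def satisfies_def
proof (intro ballI allI impI)
  fix A and v :: "nat \<Rightarrow> 'a" assume A: "A \<in> V" and v: "range v \<subseteq> carr A"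
  define w where "w x = (if x \<in> X then eval A v (\<sigma> (Var x)) else v x)" for x
  have "eval A v (\<sigma> (Var x)) \<in> carr A" if "x \<in> X" for x
    by (rule eval_closed[OF V[OF A] subst_closed[OF \<sigma>]]) (use v that in auto)
  then have "range w \<subseteq> carr A" using v by (auto simp: w_def)
  then have "eval A w s = eval A w t" using val A by (rule_tac validD)
  moreover have "eval A v (\<sigma> s) = eval A w s" "eval A v (\<sigma> t) = eval A w t"
    by (rule eval_subst[OF \<sigma>]; use st in \<open>simp add: w_def\<close>)+
  ultimately show "eval A v (fst (\<sigma> s, \<sigma> t)) = eval A v (snd (\<sigma> s, \<sigma> t))" by simp
qed

lemma exact_le_iff:
  assumes "\<sigma> \<in> substs X" and "\<tau> \<in> substs X"
  shows "exact_le V X \<sigma> \<tau> \<longleftrightarrow>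
    (\<forall>s\<in>carr (Fm X). \<forall>t\<in>carr (Fm X). valid V (\<tau> s, \<tau> t) \<longrightarrow> valid V (\<sigma> s, \<sigma> t))"
proof -
  have "canon_hom V UNIV (\<rho> s) = canon_hom V UNIV (\<rho> t) \<longleftrightarrow> valid V (\<rho> s, \<rho> t)"
    if "\<rho> \<in> substs X" "s \<in> carr (Fm X)" "t \<in> carr (Fm X)" for \<rho> s t
    using that subst_closed by (intro canon_hom_eq_iff) simp_all
  note eq = this[OF assms(1)] this[OF assms(2)]
  have "exact_le V X \<sigma> \<tau> \<longleftrightarrow> (\<forall>s\<in>carr (Fm X). \<forall>t\<in>carr (Fm X).
      canon_hom V UNIV (\<tau> s) = canon_hom V UNIV (\<tau> t) \<longrightarrow> canon_hom V UNIV (\<sigma> s) = canon_hom V UNIV (\<sigma> t))"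
    unfolding exact_le_def ker_def comp_def by blast
  then show ?thesis using eq by (simp del: carr_Fm)
qed

text \<open>The kernel of a unifier contains all valid identities, so it is determined by the
  relation that it induces on the finite free algebra.\<close>

lemma kernel_preorder_unifiers:
  assumes V: "\<And>A. A \<in> V \<Longrightarrow> is_alg A" and fin: "finite (carr (free_alg V X))"
    and "unifiers V X S \<noteq> {}"
  shows "kernel_preorder (unifiers V X S) (exact_le V X)
    (\<lambda>\<sigma>. ker (Fm X) (canon_hom V UNIV \<circ> \<sigma>))"
proof
  let ?K = "\<lambda>\<sigma>. ker (Fm X) (canon_hom V UNIV \<circ> \<sigma>)"
  let ?q = "canon_hom V X"
  let ?Q = "carr (free_alg V X)"
  have q: "?q t \<in> ?Q" if "t \<in> carr (Fm X)" for t
    using that by (auto simp: canon_hom_def free_alg_def quotientI)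
  have "image (map_prod ?q ?q) ` ?K ` unifiers V X S \<subseteq> Pow (?Q \<times> ?Q)"
    using q by (auto simp: ker_def simp del: carr_Fm)
  then have "finite (image (map_prod ?q ?q) ` ?K ` unifiers V X S)"
    using fin by (meson finite_Pow_iff finite_SigmaI finite_subset)
  moreover have "inj_on (image (map_prod ?q ?q)) (?K ` unifiers V X S)"
  proof -
    have sat: "(s, t) \<in> ?K \<sigma>"
      if \<sigma>: "\<sigma> \<in> unifiers V X S" and "(s', t') \<in> ?K \<sigma>" and st: "s \<in> carr (Fm X)" "t \<in> carr (Fm X)"
        and eq: "?q s' = ?q s" "?q t' = ?q t" for \<sigma> s t s' t'
    proof -
      have st': "s' \<in> carr (Fm X)" "t' \<in> carr (Fm X)" 
        and eq': "canon_hom V UNIV (\<sigma> s') = canon_hom V UNIV (\<sigma> t')"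
        using that(2) by (auto simp: ker_def)
      have sub: "\<sigma> \<in> substs X" using \<sigma> by (simp add: unifiers_def)
      have mem: "\<sigma> u \<in> carr (Fm UNIV)" if "u \<in> carr (Fm X)" for u
        using subst_closed[OF sub that] by simp
      have "valid V (\<sigma> s', \<sigma> s)" "valid V (\<sigma> t', \<sigma> t)"
        using eq st st' canon_hom_eq_iff valid_subst[OF V sub] by blast+
      then have "canon_hom V UNIV (\<sigma> s') = canon_hom V UNIV (\<sigma> s)"
        "canon_hom V UNIV (\<sigma> t') = canon_hom V UNIV (\<sigma> t)"
        using mem st st' canon_hom_eq_iff by blast+
      then show ?thesis using eq' st by (auto simp: ker_def)
    qed
    let ?unfold = "\<lambda>L. {(s, t). s \<in> carr (Fm X) \<and> t \<in> carr (Fm X) \<and> (?q s, ?q t) \<in> L}"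
    have "?unfold (map_prod ?q ?q ` ?K \<sigma>) = ?K \<sigma>" if \<sigma>: "\<sigma> \<in> unifiers V X S" for \<sigma>
    proof (intro set_eqI iffI)
      fix p assume "p \<in> ?unfold (map_prod ?q ?q ` ?K \<sigma>)"
      then obtain s t s' t' where p: "p = (s, t)" "s \<in> carr (Fm X)" "t \<in> carr (Fm X)"
        and K: "(s', t') \<in> ?K \<sigma>" and q: "?q s' = ?q s" "?q t' = ?q t"
        by (auto simp del: carr_Fm)
      show "p \<in> ?K \<sigma>" unfolding p(1) by (rule sat[OF \<sigma> K p(2,3) q])
    next
      fix p assume p: "p \<in> ?K \<sigma>"
      then obtain s t where st: "p = (s, t)" "s \<in> carr (Fm X)" "t \<in> carr (Fm X)"
        by (auto simp: ker_def simp del: carr_Fm)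
      have "map_prod ?q ?q p \<in> map_prod ?q ?q ` ?K \<sigma>" using p by (rule imageI)
      then show "p \<in> ?unfold (map_prod ?q ?q ` ?K \<sigma>)" using st by (simp del: carr_Fm)
    qed
    then show ?thesis by (intro inj_on_inverseI[where g = ?unfold]) (erule imageE, simp only:)
  qed
  ultimately show "finite (?K ` unifiers V X S)" by (rule finite_imageD)
qed (use assms in \<open>simp_all only: exact_le_def not_False_eq_True\<close>)

text \<open>Any invariant with finitely many values that is fine enough to imply validity bounds the size of the
  free algebra.\<close>

lemma finite_free_algI:
  assumes "finite (f ` carr (Fm X))"
    and "\<And>s t. s \<in> carr (Fm X) \<Longrightarrow> t \<in> carr (Fm X) \<Longrightarrow> f s = f t \<Longrightarrow> valid V (s, t)"
  shows "finite (carr (free_alg V X))"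
proof -
  have "free_cong V X `` {t} = canon_hom V X (inv_into (carr (Fm X)) f (f t))"
    if t: "t \<in> carr (Fm X)" for t
  proof -
    let ?u = "inv_into (carr (Fm X)) f (f t)"
    have u: "?u \<in> carr (Fm X)" "f ?u = f t"
      using t by (auto simp: inv_into_into f_inv_into_f simp del: carr_Fm)
    then have "canon_hom V X t = canon_hom V X ?u"
      using canon_hom_eq_iff[OF t u(1)] assms(2) t by metis
    then show ?thesis using t by (simp add: canon_hom_def del: carr_Fm)
  qed
  then have "carr (free_alg V X) \<subseteq> (\<lambda>k. canon_hom V X (inv_into (carr (Fm X)) f k)) ` f ` carr (Fm X)"
    by (auto simp: free_alg_def quotient_def simp del: carr_Fm)
  then show ?thesis using assms(1) finite_surj by blast
qed

lemma finite_identity_vars: "finite S \<Longrightarrow> finite (identity_vars S)"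
  by (auto simp: identity_vars_def finite_vars)

lemma identity_vars_mem:
  assumes "S \<subseteq> carr (Fm UNIV) \<times> carr (Fm UNIV)" and "(s, t) \<in> S"
  shows "s \<in> carr (Fm (identity_vars S))" and "t \<in> carr (Fm (identity_vars S))"
proof -
  have "vars s \<union> vars t \<subseteq> identity_vars S" using assms(2) by (auto simp: identity_vars_def)
  moreover have "wf_trm s" "wf_trm t" using assms by auto
  ultimately show "s \<in> carr (Fm (identity_vars S))" "t \<in> carr (Fm (identity_vars S))" by auto
qed

text \<open>A class of algebras is an arbitrary set of records here, so that its members are algebras is part of
  the notion.\<close>

definition locally_finite :: "('f::language, 'a) alg set \<Rightarrow> bool" where
  "locally_finite V \<longleftrightarrow> (\<forall>A\<in>V. is_alg A) \<and> (\<forall>X. finite X \<longrightarrow> finite (carr (free_alg V X)))"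

lemma locally_finite_kernels:
  assumes "locally_finite V" and "finite S" and "unifiable V S"
  shows "kernel_preorder (unifiers V (identity_vars S) S) (exact_le V (identity_vars S))
    (\<lambda>\<sigma>. ker (Fm (identity_vars S)) (canon_hom V UNIV \<circ> \<sigma>))"
proof (rule kernel_preorder_unifiers)
  show "unifiers V (identity_vars S) S \<noteq> {}" using assms(3) by (simp add: unifiable_def)
  show "finite (carr (free_alg V (identity_vars S)))"
    using assms(1) finite_identity_vars[OF assms(2)] by (simp add: locally_finite_def)
qed (use assms(1) in \<open>simp add: locally_finite_def\<close>)

lemma finite_unif_types: "finite (T :: unif_type set)"
proof (rule finite_subset)
  show "T \<subseteq> {Unitary, Finitary, Infinitary, Nullary}" using unif_type.exhaust by auto
qed simp

lemma unifiable_empty: "unifiable V {}"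
proof -
  have "subst_of {} Var \<in> unifiers V {} {}"
    by (auto simp: unifiers_def intro: subst_of_substs)
  then show ?thesis by (auto simp: unifiable_def identity_vars_def)
qed

lemma exact_unification_type_unitaryI:
  assumes "\<And>S. S \<subseteq> carr (Fm UNIV) \<times> carr (Fm UNIV) \<Longrightarrow> finite S \<Longrightarrow> unifiable V S \<Longrightarrow>
    exact_unifiers_type V S = Unitary"
  shows "exact_unification_type V = Unitary"
proof -
  have "{exact_unifiers_type V S | S. S \<subseteq> carr (Fm UNIV) \<times> carr (Fm UNIV) \<and> finite S \<and> unifiable V S}
    = {Unitary}" (is "?T = _")
  proof
    show "?T \<subseteq> {Unitary}" using assms by blast
    show "{Unitary} \<subseteq> ?T" using assms[of "{}"] unifiable_empty[of V] by force
  qed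
  then show ?thesis by (simp add: exact_unification_type_def)
qed

text \<open>Unitarity fails as soon as every unifier of \<open>S\<close> satisfies one of two identities while neither of
  them is satisfied by all unifiers: a greatest unifier would satisfy one of the two, and its kernel is
  contained in the kernels of all other unifiers. Local finiteness excludes the types above
  \<^const>\<open>Finitary\<close>, for \<open>S\<close> and for every other finite set of identities.\<close>

lemma exact_unification_type_finitaryI:
  assumes lf: "locally_finite V"
    and S: "S \<subseteq> carr (Fm UNIV) \<times> carr (Fm UNIV)" "finite S"
    and e: "s1 \<in> carr (Fm (identity_vars S))" "t1 \<in> carr (Fm (identity_vars S))"
      "s2 \<in> carr (Fm (identity_vars S))" "t2 \<in> carr (Fm (identity_vars S))"
    and or: "\<And>\<sigma>. \<sigma> \<in> unifiers V (identity_vars S) S \<Longrightarrow> valid V (\<sigma> s1, \<sigma> t1) \<or> valid V (\<sigma> s2, \<sigma> t2)"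
    and 1: "\<sigma>1 \<in> unifiers V (identity_vars S) S" "\<not> valid V (\<sigma>1 s1, \<sigma>1 t1)"
    and 2: "\<sigma>2 \<in> unifiers V (identity_vars S) S" "\<not> valid V (\<sigma>2 s2, \<sigma>2 t2)"
  shows "exact_unification_type V = Finitary"
proof -
  let ?T = "{exact_unifiers_type V S | S. S \<subseteq> carr (Fm UNIV) \<times> carr (Fm UNIV) \<and> finite S \<and> unifiable V S}"
  have "unifiable V S" using 1 by (auto simp: unifiable_def)
  then interpret kernel_preorder "unifiers V (identity_vars S) S" "exact_le V (identity_vars S)"
    "\<lambda>\<sigma>. ker (Fm (identity_vars S)) (canon_hom V UNIV \<circ> \<sigma>)"
    using locally_finite_kernels[OF lf S(2)] by simp
  have no_greatest: "\<not> (\<exists>g\<in>unifiers V (identity_vars S) S. \<forall>\<sigma>\<in>unifiers V (identity_vars S) S.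
      exact_le V (identity_vars S) \<sigma> g)"
  proof
    assume "\<exists>g\<in>unifiers V (identity_vars S) S. \<forall>\<sigma>\<in>unifiers V (identity_vars S) S.
      exact_le V (identity_vars S) \<sigma> g"
    then obtain g where g: "g \<in> unifiers V (identity_vars S) S"
      and le: "exact_le V (identity_vars S) \<sigma>1 g" "exact_le V (identity_vars S) \<sigma>2 g"
      using 1 2 by blast
    have "\<sigma>1 \<in> substs (identity_vars S)" "\<sigma>2 \<in> substs (identity_vars S)" "g \<in> substs (identity_vars S)"
      using 1 2 g by (auto simp: unifiers_def)
    then show False
      using or[OF g] le e 1(2) 2(2) by (auto simp: exact_le_iff simp del: carr_Fm)
  qed
  then have "exact_unifiers_type V S = Finitary"
    unfolding exact_unifiers_type_def preorder_type_eq by (rule if_not_P)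
  then have "Finitary \<in> ?T" using S \<open>unifiable V S\<close> by (metis (mono_tags, lifting) mem_Collect_eq)
  moreover have "T \<le> Finitary" if T: "T \<in> ?T" for T
  proof -
    obtain S' where S': "finite S'" "unifiable V S'" "T = exact_unifiers_type V S'" using T by blast
    then have "T = Unitary \<or> T = Finitary"
      using kernel_preorder.preorder_type_eq[OF locally_finite_kernels[OF lf S'(1,2)]]
      by (auto simp: exact_unifiers_type_def)
    then show ?thesis by (auto simp: less_eq_unif_type_def)
  qed
  ultimately have "Max ?T = Finitary" by (intro Max_eqI finite_unif_types)
  then show ?thesis by (simp add: exact_unification_type_def)
qed

section \<open>Test algebras\<close>

text \<open>Since the base type is infinite, every countable model of the axioms has a copy on it. Refuting an
  identity in a conveniently represented model is therefore enough.\<close>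

lemma valid_imp_satisfies:
  fixes B :: "('f::language, 'b::countable) alg"
  assumes inf: "infinite (UNIV :: 'a set)" and B: "B \<in> equational_class E"
    and val: "valid (equational_class E :: ('f, 'a) alg set) e"
  shows "satisfies B e"
proof -
  obtain f :: "nat \<Rightarrow> 'a" where f: "inj f" using infinite_countable_subset[OF inf] by blast
  define g :: "'b \<Rightarrow> 'a" where "g = f \<circ> to_nat"
  have g: "inj g" using f by (simp add: g_def inj_compose)
  define A :: "('f, 'a) alg" where
    "A = \<lparr>carr = g ` carr B, oper = \<lambda>f as. g (oper B f (map (inv g) as))\<rparr>"
  have ev: "eval A (g \<circ> v) t = g (eval B v t)" for v t
  proof (induction t)
    case (App f ts)
    have "map (inv g) (map (eval A (g \<circ> v)) ts) = map (eval B v) ts"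
      using App g by (simp add: comp_def)
    moreover have "oper A f as = g (oper B f (map (inv g) as))" for as by (simp add: A_def)
    ultimately show ?case by (simp only: eval.simps)
  qed simp
  have sat: "satisfies A e' \<longleftrightarrow> satisfies B e'" for e'
  proof
    assume A: "satisfies A e'"
    show "satisfies B e'" unfolding satisfies_def
    proof (intro allI impI)
      fix v :: "nat \<Rightarrow> 'b" assume "range v \<subseteq> carr B"
      then have "range (g \<circ> v) \<subseteq> carr A" by (auto simp: A_def)
      then have "g (eval B v (fst e')) = g (eval B v (snd e'))"
        using A ev unfolding satisfies_def by metis
      then show "eval B v (fst e') = eval B v (snd e')" using g by (simp add: inj_eq)
    qed
  next
    assume B: "satisfies B e'"
    show "satisfies A e'" unfolding satisfies_def
    proof (intro allI impI)
      fix w :: "nat \<Rightarrow> 'a" assume w: "range w \<subseteq> carr A"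
      have "g (inv g (w x)) = w x \<and> inv g (w x) \<in> carr B" for x
      proof -
        have "w x \<in> g ` carr B" using w by (auto simp: A_def)
        then show ?thesis using g by auto
      qed
      then have "w = g \<circ> (inv g \<circ> w)" and "range (inv g \<circ> w) \<subseteq> carr B"
        by (auto simp: fun_eq_iff)
      then show "eval A w (fst e') = eval A w (snd e')"
        using B ev unfolding satisfies_def by metis
    qed
  qed
  have "is_alg A" unfolding is_alg_def
  proof (intro allI ballI impI)
    fix h :: 'f and as assume as: "as \<in> lists (carr A)" "length as = arity h"
    have "map (inv g) as \<in> lists (carr B)"
      using as(1) g by (auto simp: A_def in_lists_conv_set)
    then show "oper A h as \<in> carr A"
      using B as(2) by (simp add: A_def equational_class_def is_alg_def)
  qed
  moreover have "carr A \<noteq> {}" using B by (simp add: A_def equational_class_def)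
  ultimately have "A \<in> equational_class E"
    using B sat by (simp add: equational_class_def)
  then have "satisfies A e" using val by (simp add: valid_def)
  then show ?thesis using sat by blast
qed

lemma satisfies_separating:
  assumes A: "is_alg A" and wf: "wf_trm s" "wf_trm t" and B: "satisfies B (s, t)"
    and sep: "\<And>a b. a \<in> carr A \<Longrightarrow> b \<in> carr A \<Longrightarrow> a \<noteq> b \<Longrightarrow> \<exists>h\<in>homs A B. h a \<noteq> h b"
  shows "satisfies A (s, t)"
  unfolding satisfies_def fst_conv snd_conv
proof (intro allI impI, rule ccontr)
  fix v :: "nat \<Rightarrow> _" assume v: "range v \<subseteq> carr A" and ne: "eval A v s \<noteq> eval A v t"
  have v': "v x \<in> carr A" for x using v by auto
  have "eval A v s \<in> carr A" "eval A v t \<in> carr A"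
    using eval_closed[OF A] wf v' by blast+
  then obtain h where h: "h \<in> homs A B" "h (eval A v s) \<noteq> h (eval A v t)"
    using sep ne by blast
  have "range (h \<circ> v) \<subseteq> carr B" using h(1) v' by (auto simp: homs_def PiE_iff)
  then have "eval B (h \<circ> v) s = eval B (h \<circ> v) t" using B by (simp add: satisfies_def)
  then show False using h(2) eval_hom[OF A h(1)] wf v' by simp
qed

lemma equational_classD:
  assumes "A \<in> equational_class E"
  shows "is_alg A" and "\<And>e. e \<in> E \<Longrightarrow> satisfies A e"
  using assms unfolding equational_class_def by blast+

lemma valid_iff_satisfies:
  fixes B :: "('f::language, 'b::countable) alg"
  assumes "infinite (UNIV :: 'a set)" and "B \<in> equational_class E"
    and sep: "\<And>A a b. A \<in> (equational_class E :: ('f, 'a) alg set) \<Longrightarrow> a \<in> carr A \<Longrightarrow> b \<in> carr A \<Longrightarrow>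
      a \<noteq> b \<Longrightarrow> \<exists>h\<in>homs A B. h a \<noteq> h b"
    and wf: "wf_trm s" "wf_trm t"
  shows "valid (equational_class E :: ('f, 'a) alg set) (s, t) \<longleftrightarrow> satisfies B (s, t)"
proof
  assume B: "satisfies B (s, t)"
  show "valid (equational_class E :: ('f, 'a) alg set) (s, t)"
    unfolding valid_def
    by (intro ballI satisfies_separating[OF _ wf B sep]) (auto intro: equational_classD)
qed (rule valid_imp_satisfies[OF assms(1,2)])

text \<open>A term over \<open>X\<close> is determined up to validity by its term function on \<open>B\<close>, a map from the finite set
  of functions from \<open>X\<close> to \<open>B\<close> to \<open>B\<close>.\<close>

lemma locally_finiteI:
  assumes V: "\<And>A. A \<in> V \<Longrightarrow> is_alg A"
    and B: "is_alg B" "finite (carr B)"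
    and val: "\<And>s t. wf_trm s \<Longrightarrow> wf_trm t \<Longrightarrow> satisfies B (s, t) \<Longrightarrow> valid V (s, t)"
  shows "locally_finite V"
  unfolding locally_finite_def
proof (intro conjI allI impI)
  fix X :: "nat set" assume X: "finite X"
  let ?f = "\<lambda>t. restrict (\<lambda>v. eval B v t) (X \<rightarrow>\<^sub>E carr B)"
  show "finite (carr (free_alg V X))"
  proof (rule finite_free_algI[where f = ?f])
    have "?f t \<in> (X \<rightarrow>\<^sub>E carr B) \<rightarrow>\<^sub>E carr B" if "t \<in> carr (Fm X)" for t
    proof (rule restrict_PiE_iff[THEN iffD2], rule ballI)
      fix v assume "v \<in> X \<rightarrow>\<^sub>E carr B"
      then show "eval B v t \<in> carr B" using eval_closed[OF B(1), of t v] that by auto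
    qed
    then have "?f ` carr (Fm X) \<subseteq> (X \<rightarrow>\<^sub>E carr B) \<rightarrow>\<^sub>E carr B" by blast
    moreover have "finite ((X \<rightarrow>\<^sub>E carr B) \<rightarrow>\<^sub>E carr B)"
      using X B by (intro finite_PiE)
    ultimately show "finite (?f ` carr (Fm X))" by (rule finite_subset)
  next
    fix s t :: "'a trm" assume st: "s \<in> carr (Fm X)" "t \<in> carr (Fm X)" and eq: "?f s = ?f t"
    have "eval B v s = eval B v t" if v: "range v \<subseteq> carr B" for v
    proof -
      have mem: "restrict v X \<in> X \<rightarrow>\<^sub>E carr B" using v by auto
      have "eval B v u = eval B (restrict v X) u" if "u \<in> carr (Fm X)" for u
        using that by (intro eval_cong) auto
      then show ?thesis using fun_cong[OF eq, of "restrict v X"] mem st by (simp del: carr_Fm)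
    qed
    then show "valid V (s, t)" using val st by (simp add: satisfies_def)
  qed
qed (use V in blast)

section \<open>Prime filters of distributive lattices\<close>

locale dist_lattice_on =
  fixes L :: "'a set" and m j :: "'a \<Rightarrow> 'a \<Rightarrow> 'a"
  assumes closed: "x \<in> L \<Longrightarrow> y \<in> L \<Longrightarrow> m x y \<in> L" "x \<in> L \<Longrightarrow> y \<in> L \<Longrightarrow> j x y \<in> L"
    and m_comm: "x \<in> L \<Longrightarrow> y \<in> L \<Longrightarrow> m x y = m y x"
    and j_comm: "x \<in> L \<Longrightarrow> y \<in> L \<Longrightarrow> j x y = j y x"
    and m_assoc: "x \<in> L \<Longrightarrow> y \<in> L \<Longrightarrow> z \<in> L \<Longrightarrow> m x (m y z) = m (m x y) z"
    and m_absorb: "x \<in> L \<Longrightarrow> y \<in> L \<Longrightarrow> m x (j x y) = x"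
    and j_absorb: "x \<in> L \<Longrightarrow> y \<in> L \<Longrightarrow> j x (m x y) = x"
    and distrib: "x \<in> L \<Longrightarrow> y \<in> L \<Longrightarrow> z \<in> L \<Longrightarrow> m x (j y z) = j (m x y) (m x z)"
begin

abbreviation below :: "'a \<Rightarrow> 'a \<Rightarrow> bool" where
  "below x y \<equiv> m x y = x"

definition filter_on :: "'a set \<Rightarrow> bool" where
  "filter_on F \<longleftrightarrow> F \<subseteq> L \<and> (\<forall>x\<in>F. \<forall>y\<in>F. m x y \<in> F) \<and> (\<forall>x\<in>F. \<forall>y\<in>L. below x y \<longrightarrow> y \<in> F)"

definition prime_filter :: "'a set \<Rightarrow> bool" where
  "prime_filter F \<longleftrightarrow> F \<subseteq> L \<and> (\<forall>x\<in>L. \<forall>y\<in>L. m x y \<in> F \<longleftrightarrow> x \<in> F \<and> y \<in> F) \<and>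
    (\<forall>x\<in>L. \<forall>y\<in>L. j x y \<in> F \<longleftrightarrow> x \<in> F \<or> y \<in> F)"

lemma m_idem: "x \<in> L \<Longrightarrow> m x x = x"
  using m_absorb[of x "m x x"] j_absorb[of x x] closed by simp

lemma below_trans:
  "below x y \<Longrightarrow> below y z \<Longrightarrow> x \<in> L \<Longrightarrow> y \<in> L \<Longrightarrow> z \<in> L \<Longrightarrow> below x z"
  by (metis m_assoc)

lemma m_below1: "x \<in> L \<Longrightarrow> y \<in> L \<Longrightarrow> below (m x y) x"
  by (metis closed(1) m_assoc m_comm m_idem)

lemma m_below2: "x \<in> L \<Longrightarrow> y \<in> L \<Longrightarrow> below (m x y) y"
  by (metis m_assoc m_idem)

lemma m_greatest:
  "below z x \<Longrightarrow> below z y \<Longrightarrow> x \<in> L \<Longrightarrow> y \<in> L \<Longrightarrow> z \<in> L \<Longrightarrow> below z (m x y)"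
  by (metis m_assoc)

lemma m_mono:
  assumes "below x y" "below u w" "x \<in> L" "y \<in> L" "u \<in> L" "w \<in> L"
  shows "below (m x u) (m y w)"
proof (rule m_greatest)
  show "below (m x u) y" using below_trans[OF m_below1 assms(1)] assms closed by simp
  show "below (m x u) w" using below_trans[OF m_below2 assms(2)] assms closed by simp
qed (use assms closed in auto)

lemma j_least:
  assumes "below x z" "below y z" "x \<in> L" "y \<in> L" "z \<in> L"
  shows "below (j x y) z"
  using assms distrib[of z x y] m_comm closed by metis

lemma filter_extend:
  assumes F: "filter_on F" and x: "x \<in> L" and ne: "F \<noteq> {}"
  defines "G \<equiv> {z \<in> L. \<exists>f\<in>F. below (m f x) z}"
  shows "filter_on G" and "F \<subseteq> G" and "x \<in> G"
proof -
  have FL: "f \<in> L" if "f \<in> F" for f using F that by (auto simp: filter_on_def)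
  show "F \<subseteq> G" using FL m_below1 x by (auto simp: G_def)
  show "x \<in> G" using FL m_below2 x ne by (auto simp: G_def)
  show "filter_on G" unfolding filter_on_def
  proof (intro conjI ballI impI)
    show "G \<subseteq> L" by (auto simp: G_def)
  next
    fix u w assume "u \<in> G" "w \<in> G"
    then obtain f g where fg: "f \<in> F" "g \<in> F" "below (m f x) u" "below (m g x) w" and L: "u \<in> L" "w \<in> L"
      by (auto simp: G_def)
    have fgL: "f \<in> L" "g \<in> L" using FL fg by auto
    then have "below (m (m f g) x) (m f x)" "below (m (m f g) x) (m g x)"
      by (simp_all add: m_mono m_below1 m_below2 m_idem x closed)
    then have "below (m (m f g) x) u" "below (m (m f g) x) w"
      using below_trans[OF _ fg(3)] below_trans[OF _ fg(4)] fgL x L closed by simp_all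
    then have "below (m (m f g) x) (m u w)"
      using m_greatest fgL x L closed by simp
    moreover have "m f g \<in> F" using F fg by (auto simp: filter_on_def)
    ultimately show "m u w \<in> G" using closed L by (auto simp: G_def)
  next
    fix u w assume u: "u \<in> G" and w: "w \<in> L" "below u w"
    then obtain f where f: "f \<in> F" "below (m f x) u" "u \<in> L" by (auto simp: G_def)
    then have "below (m f x) w" using below_trans[OF f(2) w(2)] w(1) FL x closed by simp
    then show "w \<in> G" using f w by (auto simp: G_def)
  qed
qed

text \<open>If \<open>x\<close> and \<open>y\<close> are both missing from \<open>F\<close>, maximality puts \<open>b\<close> above \<open>f \<and> x\<close> and \<open>g \<and> y\<close> for
  some \<open>f\<close>, \<open>g\<close> in \<open>F\<close>, hence above \<open>f \<and> g \<and> (x \<or> y)\<close> by distributivity, so \<open>x \<or> y\<close> is missing too.\<close>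

lemma maximal_filter_prime:
  assumes F: "filter_on F" and a: "a \<in> F" and b: "b \<in> L" "b \<notin> F"
    and max: "\<And>G. filter_on G \<Longrightarrow> F \<subseteq> G \<Longrightarrow> b \<notin> G \<Longrightarrow> G = F"
  shows "prime_filter F"
proof -
  have FL: "F \<subseteq> L" and up: "\<And>x y. x \<in> F \<Longrightarrow> y \<in> L \<Longrightarrow> below x y \<Longrightarrow> y \<in> F"
    and meet: "\<And>x y. x \<in> F \<Longrightarrow> y \<in> F \<Longrightarrow> m x y \<in> F"
    using F by (auto simp: filter_on_def)
  have ext: "\<exists>f\<in>F. below (m f x) b" if x: "x \<in> L" "x \<notin> F" for x
  proof (rule ccontr)
    let ?G = "{z \<in> L. \<exists>f\<in>F. below (m f x) z}"
    assume "\<not> ?thesis"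
    then have "b \<notin> ?G" by blast
    moreover have "filter_on ?G" "F \<subseteq> ?G" "x \<in> ?G" using filter_extend[OF F x(1)] a by blast+
    ultimately show False using max x(2) by blast
  qed
  have prime: "x \<in> F \<or> y \<in> F" if xy: "x \<in> L" "y \<in> L" "j x y \<in> F" for x y
  proof (rule ccontr)
    assume "\<not> ?thesis"
    then obtain f g where fg: "f \<in> F" "g \<in> F" "below (m f x) b" "below (m g y) b"
      using ext xy by blast
    let ?h = "m f g"
    have h: "?h \<in> F" using meet fg by blast
    have L: "f \<in> L" "g \<in> L" using fg FL by auto
    then have "below (m ?h x) (m f x)" "below (m ?h y) (m g y)"
      by (simp_all add: m_mono m_below1 m_below2 m_idem xy closed)
    then have "below (m ?h x) b" "below (m ?h y) b"
      using below_trans[OF _ fg(3)] below_trans[OF _ fg(4)] L xy b(1) closed by simp_all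
    then have "below (j (m ?h x) (m ?h y)) b" using j_least L xy b(1) closed by simp
    then have "below (m ?h (j x y)) b" using distrib[of ?h x y] L xy closed by simp
    moreover have "m ?h (j x y) \<in> F" using meet h xy(3) by blast
    ultimately show False using up b by blast
  qed
  have "m x y \<in> F \<longleftrightarrow> x \<in> F \<and> y \<in> F" if "x \<in> L" "y \<in> L" for x y
    using up[of "m x y" x] up[of "m x y" y] meet m_below1 m_below2 that by auto
  moreover have "j x y \<in> F \<longleftrightarrow> x \<in> F \<or> y \<in> F" if xy: "x \<in> L" "y \<in> L" for x y
  proof -
    have "below x (j x y)" "below y (j x y)"
      using m_absorb[OF xy] m_absorb[OF xy(2,1)] j_comm[OF xy] by simp_all
    then show ?thesis using up[of x "j x y"] up[of y "j x y"] closed(2)[OF xy] prime[OF xy] by blast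
  qed
  ultimately show ?thesis using FL by (simp add: prime_filter_def)
qed

text \<open>The prime filter theorem: Zorn's lemma is applied to the filters that contain \<open>a\<close> but not \<open>b\<close>.\<close>

lemma prime_filter_below:
  assumes a: "a \<in> L" and b: "b \<in> L" and ab: "\<not> below a b"
  shows "\<exists>F. prime_filter F \<and> a \<in> F \<and> b \<notin> F"
proof -
  let ?A = "{F. filter_on F \<and> a \<in> F \<and> b \<notin> F}"
  have "\<exists>M\<in>?A. \<forall>X\<in>?A. M \<subseteq> X \<longrightarrow> X = M"
  proof (rule subset_Zorn_nonempty)
    have "filter_on {x \<in> L. below a x}"
      using a m_greatest closed below_trans unfolding filter_on_def by blast
    then have "{x \<in> L. below a x} \<in> ?A" using a ab m_idem by blast
    then show "?A \<noteq> {}" by blast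
  next
    fix C assume "C \<noteq> {}" and chain: "subset.chain ?A C"
    then have C: "\<And>F. F \<in> C \<Longrightarrow> filter_on F \<and> a \<in> F \<and> b \<notin> F"
      and lin: "\<And>F G. F \<in> C \<Longrightarrow> G \<in> C \<Longrightarrow> F \<subseteq> G \<or> G \<subseteq> F"
      unfolding subset.chain_def by blast+
    have "filter_on (\<Union>C)" unfolding filter_on_def
    proof (intro conjI ballI impI)
      show "\<Union>C \<subseteq> L" using C unfolding filter_on_def by blast
    next
      fix x y assume "x \<in> \<Union>C" "y \<in> \<Union>C"
      then obtain F where "F \<in> C" "x \<in> F" "y \<in> F" using lin by blast
      then show "m x y \<in> \<Union>C" using C unfolding filter_on_def by blast
    next
      fix x y assume "x \<in> \<Union>C" "y \<in> L" "below x y"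
      then show "y \<in> \<Union>C" using C unfolding filter_on_def by blast
    qed
    then show "\<Union>C \<in> ?A" using C \<open>C \<noteq> {}\<close> by blast
  qed
  then obtain M where M: "filter_on M" "a \<in> M" "b \<notin> M"
    and max: "\<And>X. filter_on X \<Longrightarrow> a \<in> X \<Longrightarrow> b \<notin> X \<Longrightarrow> M \<subseteq> X \<Longrightarrow> X = M" by blast
  have "prime_filter M"
    by (rule maximal_filter_prime[OF M(1,2) b M(3)]) (use max M(2) in blast)
  then show ?thesis using M by blast
qed

lemma prime_filter_separates:
  assumes "a \<in> L" and "b \<in> L" and "a \<noteq> b"
  shows "\<exists>F. prime_filter F \<and> (a \<in> F) \<noteq> (b \<in> F)"
proof -
  have "\<not> below a b \<or> \<not> below b a" using assms m_comm by metis
  then show ?thesis using prime_filter_below assms(1,2) by blast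
qed

end

lemma length_2_conv: "length xs = 2 \<longleftrightarrow> (\<exists>x y. xs = [x, y])"
  by (auto simp: numeral_2_eq_2 length_Suc_conv)

lemma oper_closed:
  "is_alg A \<Longrightarrow> set as \<subseteq> carr A \<Longrightarrow> length as = arity f \<Longrightarrow> oper A f as \<in> carr A"
  by (simp add: is_alg_def in_lists_conv_set subset_iff)

lemma satisfiesD3:
  assumes "satisfies A (s, t)" and "x \<in> carr A" "y \<in> carr A" "z \<in> carr A"
  shows "eval A (\<lambda>n. if n = 0 then x else if n = 1 then y else z) s =
    eval A (\<lambda>n. if n = 0 then x else if n = 1 then y else z) t"
  using assms(1)[unfolded satisfies_def, rule_format,
      of "\<lambda>n. if n = 0 then x else if n = 1 then y else z"] assms(2-)
  by (simp add: image_subset_iff)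

lemma dist_lattice_onI:
  fixes A :: "('f::language, 'a) alg"
  assumes A: "is_alg A" and ar: "arity meet = 2" "arity join = 2"
    and sat: "\<And>e. e \<in> distributive_lattice_ids meet join \<Longrightarrow> satisfies A e"
  shows "dist_lattice_on (carr A) (\<lambda>x y. oper A meet [x, y]) (\<lambda>x y. oper A join [x, y])"
proof -
  let ?v = "\<lambda>x y z n. if n = 0 then x else if n = (1::nat) then y else z"
  have eq: "eval A (?v x y z) s = eval A (?v x y z) t"
    if "(s, t) \<in> distributive_lattice_ids meet join" "x \<in> carr A" "y \<in> carr A" "z \<in> carr A" for s t x y z
    using satisfiesD3[OF sat] that by blast
  note ids = eq[unfolded distributive_lattice_ids_def Let_def]
  show ?thesis
  proof
    fix x y assume "x \<in> carr A" "y \<in> carr A"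
    then show "oper A meet [x, y] \<in> carr A" "oper A join [x, y] \<in> carr A"
      using oper_closed[OF A] ar by simp_all
    show "oper A meet [x, y] = oper A meet [y, x]"
      using ids[of "App meet [Var 0, Var 1]" "App meet [Var 1, Var 0]" x y y] \<open>x \<in> _\<close> \<open>y \<in> _\<close> by simp
    show "oper A join [x, y] = oper A join [y, x]"
      using ids[of "App join [Var 0, Var 1]" "App join [Var 1, Var 0]" x y y] \<open>x \<in> _\<close> \<open>y \<in> _\<close> by simp
    show "oper A meet [x, oper A join [x, y]] = x"
      using ids[of "App meet [Var 0, App join [Var 0, Var 1]]" "Var 0" x y y] \<open>x \<in> _\<close> \<open>y \<in> _\<close> by simp
    show "oper A join [x, oper A meet [x, y]] = x"
      using ids[of "App join [Var 0, App meet [Var 0, Var 1]]" "Var 0" x y y] \<open>x \<in> _\<close> \<open>y \<in> _\<close> by simp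
  next
    fix x y z assume xyz: "x \<in> carr A" "y \<in> carr A" "z \<in> carr A"
    show "oper A meet [x, oper A meet [y, z]] = oper A meet [oper A meet [x, y], z]"
      using ids[of "App meet [Var 0, App meet [Var 1, Var 2]]" "App meet [App meet [Var 0, Var 1], Var 2]" x y z] xyz
      by simp
    show "oper A meet [x, oper A join [y, z]] = oper A join [oper A meet [x, y], oper A meet [x, z]]"
      using ids[of "App meet [Var 0, App join [Var 1, Var 2]]"
          "App join [App meet [Var 0, Var 1], App meet [Var 0, Var 2]]" x y z] xyz
      by simp
  qed
qed

section \<open>Distributive lattices\<close>

definition two_lattice :: "(lat_sym, bool) alg" where
  "two_lattice = \<lparr>carr = UNIV, oper = (\<lambda>f as. case f of
     LMeet \<Rightarrow> as ! 0 \<and> as ! 1 | LJoin \<Rightarrow> as ! 0 \<or> as ! 1)\<rparr>"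

lemma carr_two_lattice [simp]: "carr two_lattice = UNIV"
  by (simp add: two_lattice_def)

lemma two_lattice_mem: "two_lattice \<in> distributive_lattices"
  by (auto simp: distributive_lattices_def equational_class_def is_alg_def satisfies_def
      distributive_lattice_ids_def Let_def two_lattice_def)

lemma distributive_lattice_separating:
  assumes "A \<in> distributive_lattices" and "a \<in> carr A" "b \<in> carr A" "a \<noteq> b"
  shows "\<exists>h\<in>homs A two_lattice. h a \<noteq> h b"
proof -
  interpret dist_lattice_on "carr A" "\<lambda>x y. oper A LMeet [x, y]" "\<lambda>x y. oper A LJoin [x, y]"
    using assms(1) by (intro dist_lattice_onI) (auto simp: distributive_lattices_def equational_class_def)
  obtain F where F: "prime_filter F" "(a \<in> F) \<noteq> (b \<in> F)"
    using prime_filter_separates assms by blast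
  have "restrict (\<lambda>x. x \<in> F) (carr A) \<in> homs A two_lattice"
    unfolding homs_def
  proof (intro CollectI conjI allI ballI impI)
    fix f :: lat_sym and as assume as: "as \<in> lists (carr A)" "length as = arity f"
    then have "length as = 2" by (cases f) simp_all
    then obtain x y where xy: "as = [x, y]" "x \<in> carr A" "y \<in> carr A"
      using as(1) by (auto simp: length_2_conv)
    show "restrict (\<lambda>x. x \<in> F) (carr A) (oper A f as)
        = oper two_lattice f (map (restrict (\<lambda>x. x \<in> F) (carr A)) as)"
      using F(1) xy closed by (cases f) (simp_all add: prime_filter_def two_lattice_def)
  qed (simp add: two_lattice_def)
  then show ?thesis using F(2) assms by (intro bexI) auto
qed

lemma valid_distributive_lattices_iff:
  assumes "infinite (UNIV :: 'a set)" and "wf_trm s" and "wf_trm t"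
  shows "valid (distributive_lattices :: (lat_sym, 'a) alg set) (s, t) \<longleftrightarrow>
    (\<forall>u. eval two_lattice u s = eval two_lattice u t)"
proof -
  have "valid (distributive_lattices :: (lat_sym, 'a) alg set) (s, t) \<longleftrightarrow> satisfies two_lattice (s, t)"
    using two_lattice_mem distributive_lattice_separating assms
    unfolding distributive_lattices_def by (intro valid_iff_satisfies) auto
  then show ?thesis by (simp add: satisfies_def)
qed

lemma locally_finite_distributive_lattices:
  assumes "infinite (UNIV :: 'a set)"
  shows "locally_finite (distributive_lattices :: (lat_sym, 'a) alg set)"
proof (rule locally_finiteI[where B = two_lattice])
  show "valid (distributive_lattices :: (lat_sym, 'a) alg set) (s, t)"
    if "wf_trm s" "wf_trm t" "satisfies two_lattice (s, t)" for s t
    using that by (simp add: valid_distributive_lattices_iff[OF assms] satisfies_def)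
qed (auto simp: is_alg_def distributive_lattices_def equational_class_def)

lemma eval_two_lattice_const: "wf_trm t \<Longrightarrow> eval two_lattice (\<lambda>_. c) t = c"
proof (induction t)
  case (App f ts)
  then show ?case by (cases f) (auto simp: length_2_conv two_lattice_def)
qed simp

text \<open>Constant valuations satisfy every identity of lattices without constants. So any two unifiers
  \<open>\<sigma>\<close> and \<open>\<tau>\<close> of \<open>S\<close> can be glued with two fresh variables to the unifier
  \<open>x \<mapsto> (z \<and> \<sigma> x) \<or> (w \<and> \<tau> x) \<or> (z \<and> w)\<close>: depending on the truth values of \<open>z\<close> and \<open>w\<close> it
  behaves like \<open>\<sigma>\<close>, like \<open>\<tau>\<close>, or like one of the two constants, and since the first two cases do
  occur, its kernel is contained in those of \<open>\<sigma>\<close> and \<open>\<tau>\<close>. Hence the unifiers are directed.\<close>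

lemma exact_type_distributive_lattices:
  fixes V :: "(lat_sym, 'a) alg set"
  assumes inf: "infinite (UNIV :: 'a set)"
  defines "V \<equiv> distributive_lattices"
  shows "exact_unification_type V = Unitary"
proof (rule exact_unification_type_unitaryI)
  fix S :: "lat_sym identity set"
  assume S: "S \<subseteq> carr (Fm UNIV) \<times> carr (Fm UNIV)" "finite S" "unifiable V S"
  define X where "X = identity_vars S"
  have SX: "s \<in> carr (Fm X)" "t \<in> carr (Fm X)" if "(s, t) \<in> S" for s t
    using identity_vars_mem[OF S(1) that] unfolding X_def .
  have valid: "valid V (s, t) \<longleftrightarrow> (\<forall>u. eval two_lattice u s = eval two_lattice u t)"
    if "wf_trm s" "wf_trm t" for s t
    unfolding V_def by (rule valid_distributive_lattices_iff[OF inf that])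
  have lf: "locally_finite V" unfolding V_def by (rule locally_finite_distributive_lattices[OF inf])
  interpret kernel_preorder "unifiers V X S" "exact_le V X" "\<lambda>\<sigma>. ker (Fm X) (canon_hom V UNIV \<circ> \<sigma>)"
    unfolding X_def by (rule locally_finite_kernels[OF lf S(2,3)])
  have "preorder_type (unifiers V X S) (exact_le V X) = Unitary"
  proof (rule directed_unitary)
    fix \<sigma> \<tau> assume \<sigma>: "\<sigma> \<in> unifiers V X S" and \<tau>: "\<tau> \<in> unifiers V X S"
    then have sub: "\<sigma> \<in> substs X" "\<tau> \<in> substs X" by (auto simp: unifiers_def)
    define W where "W = (\<Union>x\<in>X. vars (\<sigma> (Var x)) \<union> vars (\<tau> (Var x)))"
    have "finite W" using finite_identity_vars[OF S(2)] by (auto simp: W_def X_def finite_vars)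
    obtain z where z: "z \<notin> W" using ex_new_if_finite[OF _ \<open>finite W\<close>] by auto
    obtain w where w: "w \<notin> insert z W"
      using ex_new_if_finite[of "insert z W"] \<open>finite W\<close> by auto
    define g where "g x = App LJoin [App LJoin [App LMeet [Var z, \<sigma> (Var x)], App LMeet [Var w, \<tau> (Var x)]],
      App LMeet [Var z, Var w]]" for x
    define \<rho> where "\<rho> = subst_of X g"
    have wf: "wf_trm (g x)" if "x \<in> X" for x
      using that subst_closed[OF sub(1), of "Var x"] subst_closed[OF sub(2), of "Var x"]
      by (simp add: g_def)
    have \<rho>: "\<rho> \<in> substs X" unfolding \<rho>_def by (rule subst_of_substs) (rule wf)
    have ev: "eval two_lattice u (\<rho> t) =
        (if u z then if u w then True else eval two_lattice u (\<sigma> t)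
         else if u w then eval two_lattice u (\<tau> t) else False)" if t: "t \<in> carr (Fm X)" for u t
    proof -
      have gx: "eval two_lattice u (\<rho> (Var x)) =
        (u z \<and> eval two_lattice u (\<sigma> (Var x)) \<or> u w \<and> eval two_lattice u (\<tau> (Var x)) \<or> u z \<and> u w)"
        if "x \<in> X" for x
        using that by (auto simp: \<rho>_def g_def two_lattice_def)
      note eval_\<rho> = eval_subst[OF \<rho> t] and eval_\<sigma> = eval_subst[OF sub(1) t] and eval_\<tau> = eval_subst[OF sub(2) t]
      have const: "eval two_lattice (\<lambda>_. c) t = c" for c
        using t by (simp add: eval_two_lattice_const)
      show ?thesis
      proof (cases "u z"; cases "u w")
        assume zw: "u z" "u w"
        have "eval two_lattice u (\<rho> t) = eval two_lattice (\<lambda>_. True) t"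
          by (rule eval_\<rho>) (simp add: gx zw)
        then show ?thesis using zw const by simp
      next
        assume zw: "u z" "\<not> u w"
        let ?v = "\<lambda>x. eval two_lattice u (\<sigma> (Var x))"
        have "eval two_lattice u (\<rho> t) = eval two_lattice ?v t"
          by (rule eval_\<rho>) (simp add: gx zw)
        moreover have "eval two_lattice u (\<sigma> t) = eval two_lattice ?v t"
          by (rule eval_\<sigma>) simp
        ultimately show ?thesis using zw by simp
      next
        assume zw: "\<not> u z" "u w"
        let ?v = "\<lambda>x. eval two_lattice u (\<tau> (Var x))"
        have "eval two_lattice u (\<rho> t) = eval two_lattice ?v t"
          by (rule eval_\<rho>) (simp add: gx zw)
        moreover have "eval two_lattice u (\<tau> t) = eval two_lattice ?v t"
          by (rule eval_\<tau>) simp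
        ultimately show ?thesis using zw by simp
      next
        assume zw: "\<not> u z" "\<not> u w"
        have "eval two_lattice u (\<rho> t) = eval two_lattice (\<lambda>_. False) t"
          by (rule eval_\<rho>) (simp add: gx zw)
        then show ?thesis using zw const by simp
      qed
    qed
    have unif: "eval two_lattice u (\<pi> s) = eval two_lattice u (\<pi> t)"
      if \<pi>: "\<pi> \<in> unifiers V X S" and st: "(s, t) \<in> S" for \<pi> s t u
    proof -
      have "\<pi> \<in> substs X" "valid V (\<pi> s, \<pi> t)" using \<pi> st by (auto simp: unifiers_def)
      then show ?thesis using valid subst_closed SX[OF st] by blast
    qed
    have "valid V (\<rho> s, \<rho> t)" if st: "(s, t) \<in> S" for s t
      using valid[OF subst_closed subst_closed, OF \<rho> SX(1)[OF st] \<rho> SX(2)[OF st]]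
        ev[OF SX(1)[OF st]] ev[OF SX(2)[OF st]] unif[OF \<sigma> st] unif[OF \<tau> st] by simp
    then have "\<rho> \<in> unifiers V X S" using \<rho> by (auto simp: unifiers_def)
    \<comment> \<open>Fixing the truth values of the two fresh variables recovers either unifier from the glued one.\<close>
    have le: "exact_le V X \<pi> \<rho>"
      if \<pi>: "\<pi> \<in> substs X" and W: "\<And>x. x \<in> X \<Longrightarrow> vars (\<pi> (Var x)) \<subseteq> W"
        and ex: "\<And>t u. t \<in> carr (Fm X) \<Longrightarrow>
          eval two_lattice (u(z := b, w := \<not> b)) (\<rho> t) = eval two_lattice (u(z := b, w := \<not> b)) (\<pi> t)" for \<pi> b
      unfolding exact_le_iff[OF \<pi> \<rho>]
    proof (intro ballI impI)
      fix s t assume st: "s \<in> carr (Fm X)" "t \<in> carr (Fm X)" and val: "valid V (\<rho> s, \<rho> t)"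
      have "eval two_lattice u (\<pi> s) = eval two_lattice u (\<pi> t)" for u
      proof -
        let ?u = "u(z := b, w := \<not> b)"
        have same: "eval two_lattice ?u (\<pi> r) = eval two_lattice u (\<pi> r)" if r: "r \<in> carr (Fm X)" for r
        proof -
          have "eval two_lattice ?u (\<pi> (Var x)) = eval two_lattice u (\<pi> (Var x))" if "x \<in> X" for x
            using W[OF that] z w by (intro eval_cong) auto
          then show ?thesis
            using eval_subst[OF \<pi> r, of "\<lambda>x. eval two_lattice u (\<pi> (Var x))" two_lattice ?u]
              eval_subst[OF \<pi> r, of "\<lambda>x. eval two_lattice u (\<pi> (Var x))" two_lattice u] by simp
        qed
        have "eval two_lattice ?u (\<rho> s) = eval two_lattice ?u (\<rho> t)"
          using val valid[OF subst_closed[OF \<rho> st(1)] subst_closed[OF \<rho> st(2)]] by blast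
        then show ?thesis using ex[OF st(1)] ex[OF st(2)] same[OF st(1)] same[OF st(2)] by simp
      qed
      then show "valid V (\<pi> s, \<pi> t)"
        using valid[OF subst_closed[OF \<pi> st(1)] subst_closed[OF \<pi> st(2)]] by blast
    qed
    have "w \<noteq> z" using w by blast
    have "exact_le V X \<sigma> \<rho>"
      by (rule le[OF sub(1), where b = True]) (use ev \<open>w \<noteq> z\<close> in \<open>auto simp: W_def\<close>)
    moreover have "exact_le V X \<tau> \<rho>"
      by (rule le[OF sub(2), where b = False]) (use ev \<open>w \<noteq> z\<close> in \<open>auto simp: W_def\<close>)
    moreover note \<open>\<rho> \<in> unifiers V X S\<close>
    ultimately show "\<exists>\<rho>\<in>unifiers V X S. exact_le V X \<sigma> \<rho> \<and> exact_le V X \<tau> \<rho>" by blast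
  qed
  then show "exact_unifiers_type V S = Unitary" by (simp add: exact_unifiers_type_def X_def)
qed

section \<open>Varieties in which the top element of the free algebras is join-prime\<close>

text \<open>A most general exact unifier of \<open>x \<or> y \<approx> 1\<close> would send \<open>x\<close> or \<open>y\<close> to \<open>1\<close>, whereas the unifiers
  \<open>(x, 1)\<close> and \<open>(1, x)\<close> rule out either choice.\<close>

lemma exact_type_join_prime:
  fixes V :: "('f::language, 'a) alg set"
  assumes lf: "locally_finite V" and ar: "arity join = 2" "arity one = 0"
    and prime: "\<And>s t. wf_trm s \<Longrightarrow> wf_trm t \<Longrightarrow> valid V (App join [s, t], App one []) \<Longrightarrow>
      valid V (s, App one []) \<or> valid V (t, App one [])"
    and top: "valid V (App join [Var 0, App one []], App one [])"
      "valid V (App join [App one [], Var 0], App one [])"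
    and nontrivial: "\<not> valid V (Var 0, App one [])"
  shows "exact_unification_type V = Finitary"
proof -
  define S :: "'f identity set" where "S = {(App join [Var 0, Var 1], App one [])}"
  have X: "identity_vars S = {0, 1}" by (auto simp: S_def identity_vars_def)
  define g1 g2 :: "nat \<Rightarrow> 'f trm" where "g1 x = (if x = 0 then Var 0 else App one [])"
    and "g2 x = (if x = 0 then App one [] else Var 0)" for x
  have sub: "subst_of {0, 1} g1 \<in> substs {0, 1}" "subst_of {0, 1} g2 \<in> substs {0, 1}"
    by (rule subst_of_substs; use ar in \<open>auto simp: g1_def g2_def\<close>)+
  have app: "\<sigma> (App join [Var 0, Var 1]) = App join [\<sigma> (Var 0), \<sigma> (Var 1)]"
    "\<sigma> (App one []) = App one []" if "\<sigma> \<in> substs {0, 1}" for \<sigma> :: "'f trm \<Rightarrow> 'f trm"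
    using subst_App[OF that] ar by simp_all
  have unif: "\<sigma> \<in> unifiers V {0, 1} S \<longleftrightarrow> \<sigma> \<in> substs {0, 1} \<and>
      valid V (App join [\<sigma> (Var 0), \<sigma> (Var 1)], App one [])" for \<sigma>
    by (auto simp: unifiers_def S_def app simp del: One_nat_def)
  show ?thesis
  proof (rule exact_unification_type_finitaryI[OF lf, where S = S])
    show "S \<subseteq> carr (Fm UNIV) \<times> carr (Fm UNIV)" "finite S" using ar by (auto simp: S_def)
    show "Var 0 \<in> carr (Fm (identity_vars S))" "App one [] \<in> carr (Fm (identity_vars S))"
      "Var 1 \<in> carr (Fm (identity_vars S))" "App one [] \<in> carr (Fm (identity_vars S))"
      using X ar by auto
    show "valid V (\<sigma> (Var 0), \<sigma> (App one [])) \<or> valid V (\<sigma> (Var 1), \<sigma> (App one []))"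
      if "\<sigma> \<in> unifiers V (identity_vars S) S" for \<sigma>
    proof -
      have \<sigma>: "\<sigma> \<in> substs {0, 1}" "valid V (App join [\<sigma> (Var 0), \<sigma> (Var 1)], App one [])"
        using that unfolding X unif by auto
      then show ?thesis using prime subst_closed[OF \<sigma>(1)] app(2)[OF \<sigma>(1)] by simp
    qed
    show "subst_of {0, 1} g1 \<in> unifiers V (identity_vars S) S"
      "subst_of {0, 1} g2 \<in> unifiers V (identity_vars S) S"
      unfolding X unif using sub top by (simp_all add: g1_def g2_def)
    show "\<not> valid V (subst_of {0, 1} g1 (Var 0), subst_of {0, 1} g1 (App one []))"
      "\<not> valid V (subst_of {0, 1} g2 (Var 1), subst_of {0, 1} g2 (App one []))"
      unfolding app(2)[OF sub(1)] app(2)[OF sub(2)] using nontrivial by (simp_all add: g1_def g2_def)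
  qed
qed

section \<open>Bounded distributive lattices\<close>

definition two_blattice :: "(blat_sym, bool) alg" where
  "two_blattice = \<lparr>carr = UNIV, oper = (\<lambda>f as. case f of
     BMeet \<Rightarrow> as ! 0 \<and> as ! 1 | BJoin \<Rightarrow> as ! 0 \<or> as ! 1 | BZero \<Rightarrow> False | BOne \<Rightarrow> True)\<rparr>"

lemma carr_two_blattice [simp]: "carr two_blattice = UNIV"
  by (simp add: two_blattice_def)

lemma two_blattice_mem: "two_blattice \<in> bounded_distributive_lattices"
  by (auto simp: bounded_distributive_lattices_def equational_class_def is_alg_def satisfies_def
      distributive_lattice_ids_def bound_ids_def Let_def two_blattice_def)

lemma boundsD:
  fixes A :: "('f::language, 'a) alg"
  assumes "is_alg A" and "\<And>e. e \<in> bound_ids meet join zero one \<Longrightarrow> satisfies A e"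
    and "arity zero = 0" "arity one = 0"
  shows "oper A zero [] \<in> carr A" and "oper A one [] \<in> carr A"
    and "x \<in> carr A \<Longrightarrow> oper A meet [x, oper A zero []] = oper A zero []"
    and "x \<in> carr A \<Longrightarrow> oper A join [x, oper A one []] = oper A one []"
proof -
  show "oper A zero [] \<in> carr A" "oper A one [] \<in> carr A"
    using oper_closed[OF assms(1)] assms(3,4) by simp_all
  show "oper A meet [x, oper A zero []] = oper A zero []" if "x \<in> carr A"
    using satisfiesD3[of A "App meet [Var 0, App zero []]" "App zero []" x x x] assms(2) that
    by (simp add: bound_ids_def Let_def)
  show "oper A join [x, oper A one []] = oper A one []" if "x \<in> carr A"
    using satisfiesD3[of A "App join [Var 0, App one []]" "App one []" x x x] assms(2) that
    by (simp add: bound_ids_def Let_def)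
qed

lemma (in dist_lattice_on) prime_filter_bounds:
  assumes "prime_filter F" and "a \<in> L" "b \<in> L" "(a \<in> F) \<noteq> (b \<in> F)"
    and zero: "zero \<in> L" "\<And>x. x \<in> L \<Longrightarrow> m x zero = zero"
    and one: "one \<in> L" "\<And>x. x \<in> L \<Longrightarrow> j x one = one"
  shows "zero \<notin> F" and "one \<in> F"
proof -
  obtain c d where cd: "c \<in> L" "d \<in> L" "c \<in> F" "d \<notin> F" using assms(2-4) by blast
  show "zero \<notin> F" using assms(1) cd zero(1) zero(2)[of d] unfolding prime_filter_def by metis
  show "one \<in> F" using assms(1) cd one(1) one(2)[of c] unfolding prime_filter_def by metis
qed

lemma bounded_distributive_lattice_separating:
  assumes "A \<in> bounded_distributive_lattices" and "a \<in> carr A" "b \<in> carr A" "a \<noteq> b"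
  shows "\<exists>h\<in>homs A two_blattice. h a \<noteq> h b"
proof -
  have A: "is_alg A" "\<And>e. e \<in> distributive_lattice_ids BMeet BJoin \<Longrightarrow> satisfies A e"
    "\<And>e. e \<in> bound_ids BMeet BJoin BZero BOne \<Longrightarrow> satisfies A e"
    using assms(1) by (auto simp: bounded_distributive_lattices_def equational_class_def)
  interpret dist_lattice_on "carr A" "\<lambda>x y. oper A BMeet [x, y]" "\<lambda>x y. oper A BJoin [x, y]"
    using A by (intro dist_lattice_onI) auto
  note bounds = boundsD[OF A(1,3), OF _ arity_blat_sym.simps(3,4), simplified]
  obtain F where F: "prime_filter F" "(a \<in> F) \<noteq> (b \<in> F)"
    using prime_filter_separates assms by blast
  note F01 = prime_filter_bounds[OF F(1) assms(2,3) F(2) bounds(1) bounds(3) bounds(2) bounds(4)]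
  have "restrict (\<lambda>x. x \<in> F) (carr A) \<in> homs A two_blattice"
    unfolding homs_def
  proof (intro CollectI conjI allI ballI impI)
    fix f :: blat_sym and as assume as: "as \<in> lists (carr A)" "length as = arity f"
    show "restrict (\<lambda>x. x \<in> F) (carr A) (oper A f as)
        = oper two_blattice f (map (restrict (\<lambda>x. x \<in> F) (carr A)) as)"
      using as F(1) closed bounds(1,2) F01
      by (cases f) (auto simp: prime_filter_def two_blattice_def length_2_conv)
  qed (simp add: two_blattice_def)
  then show ?thesis using F(2) assms by (intro bexI) auto
qed

lemma valid_bounded_distributive_lattices_iff:
  assumes "infinite (UNIV :: 'a set)" and "wf_trm s" and "wf_trm t"
  shows "valid (bounded_distributive_lattices :: (blat_sym, 'a) alg set) (s, t) \<longleftrightarrow>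
    (\<forall>u. eval two_blattice u s = eval two_blattice u t)"
proof -
  have "valid (bounded_distributive_lattices :: (blat_sym, 'a) alg set) (s, t) \<longleftrightarrow> satisfies two_blattice (s, t)"
    using two_blattice_mem bounded_distributive_lattice_separating assms
    unfolding bounded_distributive_lattices_def by (intro valid_iff_satisfies) auto
  then show ?thesis by (simp add: satisfies_def)
qed

lemma locally_finite_bounded_distributive_lattices:
  assumes "infinite (UNIV :: 'a set)"
  shows "locally_finite (bounded_distributive_lattices :: (blat_sym, 'a) alg set)"
proof (rule locally_finiteI[where B = two_blattice])
  show "valid (bounded_distributive_lattices :: (blat_sym, 'a) alg set) (s, t)"
    if "wf_trm s" "wf_trm t" "satisfies two_blattice (s, t)" for s t
    using that by (simp add: valid_bounded_distributive_lattices_iff[OF assms] satisfies_def)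
qed (auto simp: is_alg_def bounded_distributive_lattices_def equational_class_def)

text \<open>The operations are monotone, so the all-false valuation decides whether a term equals \<open>1\<close>. As a
  disjunction that is true there has a disjunct that is, \<open>1\<close> is join-prime in the free algebras.\<close>

lemma eval_two_blattice_mono:
  assumes "wf_trm t" and "eval two_blattice (\<lambda>_. False) t"
  shows "eval two_blattice u t"
proof -
  have "eval two_blattice (\<lambda>_. False) t \<le> eval two_blattice u t"
  proof (rule eval_rel[where R = "(\<le>)", OF _ assms(1)])
    fix f :: blat_sym and as bs :: "bool list" assume "length as = arity f" "list_all2 (\<le>) as bs"
    then show "oper two_blattice f as \<le> oper two_blattice f bs"
      by (cases f) (auto simp: two_blattice_def length_2_conv list_all2_Cons1)
  qed simp
  then show ?thesis using assms(2) by simp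
qed

lemma exact_type_bounded_distributive_lattices:
  assumes inf: "infinite (UNIV :: 'a set)"
  shows "exact_unification_type (bounded_distributive_lattices :: (blat_sym, 'a) alg set) = Finitary"
proof (rule exact_type_join_prime[where join = BJoin and one = BOne])
  note valid = valid_bounded_distributive_lattices_iff[OF inf]
  let ?V = "bounded_distributive_lattices :: (blat_sym, 'a) alg set"
  show "locally_finite ?V" by (rule locally_finite_bounded_distributive_lattices[OF inf])
  have one: "eval two_blattice u (App BOne []) = True" for u by (simp add: two_blattice_def)
  have join: "eval two_blattice u (App BJoin [s, t]) = (eval two_blattice u s \<or> eval two_blattice u t)" for u s t
    by (simp add: two_blattice_def)
  fix s t :: "blat_sym trm"
  assume wf: "wf_trm s" "wf_trm t" and st: "valid ?V (App BJoin [s, t], App BOne [])"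
  have "eval two_blattice (\<lambda>_. False) s \<or> eval two_blattice (\<lambda>_. False) t"
    using st wf by (simp add: valid join one del: eval.simps)
  then show "valid ?V (s, App BOne []) \<or> valid ?V (t, App BOne [])"
    using wf eval_two_blattice_mono by (auto simp: valid one simp del: eval.simps)
qed (auto simp: valid_bounded_distributive_lattices_iff[OF inf] two_blattice_def)

section \<open>De Morgan algebras\<close>

text \<open>The four-element De Morgan algebra, whose two fixed points of negation are \<open>(False, True)\<close> and
  \<open>(True, False)\<close>. The two components are the values of a prime filter \<open>F\<close> and of its conjugate
  \<open>{x. \<not> x \<notin> F}\<close>; negation complements and exchanges them.\<close>

definition four :: "(dm_sym, bool \<times> bool) alg" where
  "four = \<lparr>carr = UNIV, oper = (\<lambda>f as. case f of
     DMeet \<Rightarrow> (fst (as ! 0) \<and> fst (as ! 1), snd (as ! 0) \<and> snd (as ! 1))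
   | DJoin \<Rightarrow> (fst (as ! 0) \<or> fst (as ! 1), snd (as ! 0) \<or> snd (as ! 1))
   | DZero \<Rightarrow> (False, False)
   | DOne \<Rightarrow> (True, True)
   | DNeg \<Rightarrow> (\<not> snd (as ! 0), \<not> fst (as ! 0)))\<rparr>"

lemma carr_four [simp]: "carr four = UNIV"
  by (simp add: four_def)

lemma oper_four [simp]:
  "oper four DMeet [p, q] = (fst p \<and> fst q, snd p \<and> snd q)"
  "oper four DJoin [p, q] = (fst p \<or> fst q, snd p \<or> snd q)"
  "oper four DZero [] = (False, False)"
  "oper four DOne [] = (True, True)"
  "oper four DNeg [p] = (\<not> snd p, \<not> fst p)"
  by (simp_all add: four_def)

lemma four_mem: "four \<in> de_morgan_algebras"
  by (auto simp: de_morgan_algebras_def equational_class_def is_alg_def satisfies_def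
      distributive_lattice_ids_def bound_ids_def de_morgan_ids_def Let_def prod_eq_iff)

lemma length_1_conv: "length xs = 1 \<longleftrightarrow> (\<exists>x. xs = [x])"
  by (auto simp: length_Suc_conv)

lemma dm_args:
  assumes "length as = arity (f :: dm_sym)"
  obtains x y where "f = DMeet" "as = [x, y]" | x y where "f = DJoin" "as = [x, y]"
    | "f = DZero" "as = []" | "f = DOne" "as = []" | x where "f = DNeg" "as = [x]"
  using assms by (cases f) (auto simp: length_2_conv length_1_conv simp del: One_nat_def)

text \<open>The three-element Kleene chain, as the subalgebra of the four-element algebra with the middle element
  \<open>(False, True)\<close>.\<close>

definition three :: "(dm_sym, bool \<times> bool) alg" where
  "three = four\<lparr>carr := {p. fst p \<longrightarrow> snd p}\<rparr>"

lemma three_simps [simp]: "carr three = {p. fst p \<longrightarrow> snd p}" "oper three = oper four"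
  by (simp_all add: three_def)

lemma is_alg_three: "is_alg three"
  unfolding is_alg_def
proof (intro allI ballI impI)
  fix f :: dm_sym and as assume as: "as \<in> lists (carr three)" and len: "length as = arity f"
  show "oper three f as \<in> carr three" using len as by (cases rule: dm_args) auto
qed

lemma eval_three: "eval three v t = eval four v t"
proof (induction t)
  case (App f ts)
  then have "map (eval three v) ts = map (eval four v) ts" by simp
  then show ?case by (simp only: eval.simps three_simps)
qed simp

lemma three_mem: "three \<in> kleene_algebras"
  unfolding kleene_algebras_def equational_class_def
proof (intro CollectI conjI ballI)
  show "is_alg three" by (rule is_alg_three)
  show "carr three \<noteq> {}" by auto
  fix e assume "e \<in> distributive_lattice_ids DMeet DJoin \<union> bound_ids DMeet DJoin DZero DOne \<union>
       de_morgan_ids DMeet DJoin DNeg \<union> kleene_ids DMeet DJoin DNeg"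
  then consider "e \<in> distributive_lattice_ids DMeet DJoin \<union> bound_ids DMeet DJoin DZero DOne \<union>
       de_morgan_ids DMeet DJoin DNeg" | "e \<in> kleene_ids DMeet DJoin DNeg" by blast
  then show "satisfies three e"
  proof cases
    case 1
    then have "satisfies four e" using four_mem by (simp add: de_morgan_algebras_def equational_class_def)
    then show ?thesis by (simp add: satisfies_def eval_three)
  next
    case 2
    show ?thesis unfolding satisfies_def
    proof (intro allI impI)
      fix v :: "nat \<Rightarrow> bool \<times> bool" assume "range v \<subseteq> carr three"
      then have v: "fst (v x) \<longrightarrow> snd (v x)" for x by auto
      show "eval three v (fst e) = eval three v (snd e)"
        using 2 v[of 0] v[of 1] by (auto simp: kleene_ids_def Let_def prod_eq_iff)
    qed
  qed
qed

locale de_morgan_on = dist_lattice_on +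
  fixes n :: "'a \<Rightarrow> 'a" and zero one :: 'a
  assumes n_closed: "x \<in> L \<Longrightarrow> n x \<in> L" and bounds_closed: "zero \<in> L" "one \<in> L"
    and zero: "x \<in> L \<Longrightarrow> m x zero = zero" and one: "x \<in> L \<Longrightarrow> j x one = one"
    and n_n: "x \<in> L \<Longrightarrow> n (n x) = x"
    and n_m: "x \<in> L \<Longrightarrow> y \<in> L \<Longrightarrow> n (m x y) = j (n x) (n y)"
begin

lemma n_j: "x \<in> L \<Longrightarrow> y \<in> L \<Longrightarrow> n (j x y) = m (n x) (n y)"
  using n_m[of "n x" "n y"] n_n n_n[of "m (n x) (n y)"] n_closed closed by simp

lemma n_zero: "n zero = one"
proof -
  have "n zero = n (m zero (n one))"
    using zero[of "n one"] m_comm bounds_closed n_closed by simp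
  also have "\<dots> = j (n zero) one" using n_m n_n bounds_closed n_closed by simp
  also have "\<dots> = one" using one bounds_closed n_closed by simp
  finally show ?thesis .
qed

lemma n_one: "n one = zero"
  using n_n[of zero] n_zero bounds_closed by simp

text \<open>The involution on prime filters that represents negation in the duality for De Morgan algebras.\<close>

definition conjugate :: "'a set \<Rightarrow> 'a set" where
  "conjugate F = {x \<in> L. n x \<notin> F}"

lemma conjugate_prime:
  assumes "prime_filter F"
  shows "prime_filter (conjugate F)"
  using assms closed n_closed unfolding prime_filter_def conjugate_def by (auto simp: n_m n_j)

end

lemma de_morgan_onI:
  assumes A: "A \<in> de_morgan_algebras"
  shows "de_morgan_on (carr A) (\<lambda>x y. oper A DMeet [x, y]) (\<lambda>x y. oper A DJoin [x, y])
    (\<lambda>x. oper A DNeg [x]) (oper A DZero []) (oper A DOne [])"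
proof -
  note E = equational_classD[OF A[unfolded de_morgan_algebras_def]]
  have alg: "is_alg A" by (rule E(1))
  have dl: "\<And>e. e \<in> distributive_lattice_ids DMeet DJoin \<Longrightarrow> satisfies A e"
    and bd: "\<And>e. e \<in> bound_ids DMeet DJoin DZero DOne \<Longrightarrow> satisfies A e"
    and dm: "\<And>e. e \<in> de_morgan_ids DMeet DJoin DNeg \<Longrightarrow> satisfies A e"
    using E(2) by simp_all
  interpret dist_lattice_on "carr A" "\<lambda>x y. oper A DMeet [x, y]" "\<lambda>x y. oper A DJoin [x, y]"
    using alg dl by (intro dist_lattice_onI) auto
  note bounds = boundsD[OF alg bd]
  show ?thesis
  proof
    show "oper A DZero [] \<in> carr A" "oper A DOne [] \<in> carr A" using bounds(1,2) by simp_all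
    fix x assume x: "x \<in> carr A"
    show "oper A DNeg [x] \<in> carr A" using oper_closed[OF alg] x by simp
    show "oper A DMeet [x, oper A DZero []] = oper A DZero []"
      "oper A DJoin [x, oper A DOne []] = oper A DOne []"
      using bounds(3,4) x by simp_all
    show "oper A DNeg [oper A DNeg [x]] = x"
      using satisfiesD3[OF dm x x x, of "App DNeg [App DNeg [Var 0]]" "Var 0"]
      by (simp add: de_morgan_ids_def Let_def)
    show "oper A DNeg [oper A DMeet [x, y]] = oper A DJoin [oper A DNeg [x], oper A DNeg [y]]"
      if y: "y \<in> carr A" for y
      using satisfiesD3[OF dm x y y, of "App DNeg [App DMeet [Var 0, Var 1]]"
          "App DJoin [App DNeg [Var 0], App DNeg [Var 1]]"]
      by (simp add: de_morgan_ids_def Let_def)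
  qed
qed

definition four_hom :: "(dm_sym, 'a) alg \<Rightarrow> 'a set \<Rightarrow> 'a \<Rightarrow> bool \<times> bool" where
  "four_hom A F = (\<lambda>x\<in>carr A. (x \<in> F, oper A DNeg [x] \<notin> F))"

lemma four_hom:
  assumes A: "A \<in> de_morgan_algebras"
    and F: "dist_lattice_on.prime_filter (carr A) (\<lambda>x y. oper A DMeet [x, y]) (\<lambda>x y. oper A DJoin [x, y]) F"
    and ab: "a \<in> carr A" "b \<in> carr A" "(a \<in> F) \<noteq> (b \<in> F)"
  shows "four_hom A F \<in> homs A four"
proof -
  interpret de_morgan_on "carr A" "\<lambda>x y. oper A DMeet [x, y]" "\<lambda>x y. oper A DJoin [x, y]"
    "\<lambda>x. oper A DNeg [x]" "oper A DZero []" "oper A DOne []"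
    by (rule de_morgan_onI[OF A])
  note F01 = prime_filter_bounds[OF F ab bounds_closed(1) zero bounds_closed(2) one]
  show ?thesis unfolding homs_def
  proof (intro CollectI conjI allI ballI impI)
    fix f :: dm_sym and as assume as: "as \<in> lists (carr A)" "length as = arity f"
    show "four_hom A F (oper A f as) = oper four f (map (four_hom A F) as)"
      using as(2)
    proof (cases rule: dm_args)
      case (1 x y)
      then show ?thesis using F as(1) closed n_closed by (simp add: four_hom_def prime_filter_def n_m)
    next
      case (2 x y)
      then show ?thesis using F as(1) closed n_closed by (simp add: four_hom_def prime_filter_def n_j)
    next
      case 3
      then show ?thesis using F01 bounds_closed by (simp add: four_hom_def n_zero)
    next
      case 4
      then show ?thesis using F01 bounds_closed by (simp add: four_hom_def n_one)
    next
      case (5 x)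
      then show ?thesis using as(1) n_closed by (simp add: four_hom_def n_n)
    qed
  qed (simp add: four_hom_def)
qed

lemma de_morgan_separating:
  assumes A: "A \<in> de_morgan_algebras" and ab: "a \<in> carr A" "b \<in> carr A" "a \<noteq> b"
  shows "\<exists>h\<in>homs A four. h a \<noteq> h b"
proof -
  interpret de_morgan_on "carr A" "\<lambda>x y. oper A DMeet [x, y]" "\<lambda>x y. oper A DJoin [x, y]"
    "\<lambda>x. oper A DNeg [x]" "oper A DZero []" "oper A DOne []"
    by (rule de_morgan_onI[OF A])
  obtain F where F: "prime_filter F" "(a \<in> F) \<noteq> (b \<in> F)"
    using prime_filter_separates[OF ab] by blast
  show ?thesis
    by (rule bexI[OF _ four_hom[OF A F(1) ab(1,2) F(2)]]) (use F(2) ab in \<open>simp add: four_hom_def\<close>)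
qed

lemma valid_de_morgan_iff:
  assumes "infinite (UNIV :: 'a set)" and "wf_trm s" and "wf_trm t"
  shows "valid (de_morgan_algebras :: (dm_sym, 'a) alg set) (s, t) \<longleftrightarrow>
    (\<forall>u. eval four u s = eval four u t)"
proof -
  have "valid (de_morgan_algebras :: (dm_sym, 'a) alg set) (s, t) \<longleftrightarrow> satisfies four (s, t)"
    using four_mem de_morgan_separating assms
    unfolding de_morgan_algebras_def by (intro valid_iff_satisfies) auto
  then show ?thesis by (simp add: satisfies_def)
qed

text \<open>All operations, negation included, are monotone in the information order, in which the first
  components increase and the second ones decrease. Its least element is \<open>(False, True)\<close>.\<close>

lemma eval_four_information_mono:
  assumes "wf_trm t" and "fst (eval four (\<lambda>_. (False, True)) t)"
  shows "fst (eval four u t)"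
proof -
  let ?R = "\<lambda>p q. (fst p \<longrightarrow> fst q) \<and> (snd q \<longrightarrow> snd p)"
  have "?R (eval four (\<lambda>_. (False, True)) t) (eval four u t)"
  proof (rule eval_rel[where R = ?R, OF _ assms(1)])
    fix f :: dm_sym and as bs :: "(bool \<times> bool) list"
    assume "length as = arity f" "list_all2 ?R as bs"
    then show "?R (oper four f as) (oper four f bs)"
      by (cases rule: dm_args) (auto simp: list_all2_Cons1)
  qed simp
  then show ?thesis using assms(2) by simp
qed

text \<open>Exchanging the components is an automorphism, so statements about first components carry over to
  second components.\<close>

lemma eval_four_swap:
  assumes "wf_trm t"
  shows "eval four (\<lambda>x. prod.swap (u x)) t = prod.swap (eval four u t)"
proof -
  let ?R = "\<lambda>p q. p = prod.swap q"
  have "?R (eval four (\<lambda>x. prod.swap (u x)) t) (eval four u t)"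
  proof (rule eval_rel[where R = ?R, OF _ assms(1)])
    fix f :: dm_sym and as bs :: "(bool \<times> bool) list"
    assume "length as = arity f" "list_all2 ?R as bs"
    then show "?R (oper four f as) (oper four f bs)"
      by (cases rule: dm_args) (auto simp: list_all2_Cons1)
  qed simp
  then show ?thesis .
qed

lemma exact_type_de_morgan:
  assumes inf: "infinite (UNIV :: 'a set)"
  shows "exact_unification_type (de_morgan_algebras :: (dm_sym, 'a) alg set) = Finitary"
proof (rule exact_type_join_prime[where join = DJoin and one = DOne])
  let ?V = "de_morgan_algebras :: (dm_sym, 'a) alg set"
  note valid = valid_de_morgan_iff[OF inf]
  show "locally_finite ?V"
  proof (rule locally_finiteI[where B = four])
    show "valid ?V (s, t)" if "wf_trm s" "wf_trm t" "satisfies four (s, t)" for s t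
      using that by (simp add: valid satisfies_def)
  qed (auto simp: is_alg_def de_morgan_algebras_def equational_class_def)
  let ?c = "\<lambda>_ :: nat. (False, True)"
  \<comment> \<open>The constant valuation at the information-least element decides whether a term equals \<open>1\<close>.\<close>
  have one: "valid ?V (t, App DOne [])" if t: "wf_trm t" "fst (eval four ?c t)" for t
  proof -
    have "eval four u t = (True, True)" for u
    proof -
      have "fst (eval four u t)" "fst (eval four (\<lambda>x. prod.swap (u x)) t)"
        by (rule eval_four_information_mono[OF t])+
      then show ?thesis using eval_four_swap[OF t(1), of u] by (simp add: prod_eq_iff)
    qed
    then show ?thesis using t(1) by (simp add: valid)
  qed
  show "valid ?V (s, App DOne []) \<or> valid ?V (t, App DOne [])"
    if wf: "wf_trm s" "wf_trm t" and st: "valid ?V (App DJoin [s, t], App DOne [])" for s t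
  proof -
    have "eval four ?c (App DJoin [s, t]) = eval four ?c (App DOne [])"
      using st wf valid[of "App DJoin [s, t]" "App DOne []"] by simp
    then show ?thesis using one wf by auto
  qed
qed (auto simp: valid_de_morgan_iff[OF inf] split: prod.splits)

section \<open>Kleene algebras\<close>

lemma kleene_de_morgan: "A \<in> kleene_algebras \<Longrightarrow> A \<in> de_morgan_algebras"
  by (simp add: kleene_algebras_def de_morgan_algebras_def equational_class_def)

lemma kleeneD:
  assumes "A \<in> kleene_algebras" and "x \<in> carr A" "y \<in> carr A"
  shows "oper A DMeet [oper A DMeet [x, oper A DNeg [x]], oper A DJoin [y, oper A DNeg [y]]] =
    oper A DMeet [x, oper A DNeg [x]]"
proof -
  have "satisfies A (App DMeet [App DMeet [Var 0, App DNeg [Var 0]], App DJoin [Var 1, App DNeg [Var 1]]],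
      App DMeet [Var 0, App DNeg [Var 0]])"
    using assms(1) by (simp add: kleene_algebras_def equational_class_def kleene_ids_def Let_def)
  from satisfiesD3[OF this assms(2,3,3)] show ?thesis by simp
qed

text \<open>The Kleene inequality forces a prime filter to be comparable with its conjugate: if some \<open>x\<close> and
  \<open>\<not> x\<close> both lie in \<open>F\<close>, then \<open>F\<close> contains \<open>y \<or> \<not> y\<close> for all \<open>y\<close>. The smaller of the two yields a
  homomorphism into the three-element chain.\<close>

lemma kleene_separating:
  assumes A: "A \<in> kleene_algebras" and ab: "a \<in> carr A" "b \<in> carr A" "a \<noteq> b"
  shows "\<exists>h\<in>homs A three. h a \<noteq> h b"
proof -
  note dm = kleene_de_morgan[OF A]
  interpret de_morgan_on "carr A" "\<lambda>x y. oper A DMeet [x, y]" "\<lambda>x y. oper A DJoin [x, y]"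
    "\<lambda>x. oper A DNeg [x]" "oper A DZero []" "oper A DOne []"
    by (rule de_morgan_onI[OF dm])
  obtain F where F: "prime_filter F" "(a \<in> F) \<noteq> (b \<in> F)"
    using prime_filter_separates[OF ab] by blast
  let ?n = "\<lambda>x. oper A DNeg [x]"
  have into_three: "four_hom A G \<in> homs A three"
    if G: "prime_filter G" "(c \<in> G) \<noteq> (d \<in> G)" "c \<in> carr A" "d \<in> carr A"
      and sub: "\<And>x. x \<in> carr A \<Longrightarrow> x \<in> G \<Longrightarrow> ?n x \<notin> G" for G c d
  proof -
    have "four_hom A G \<in> homs A four" by (rule four_hom[OF dm G(1,3,4,2)])
    then show ?thesis using sub by (simp add: homs_def four_hom_def)
  qed
  show ?thesis
  proof (cases "\<forall>x\<in>carr A. x \<in> F \<longrightarrow> ?n x \<notin> F")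
    case True
    show ?thesis
      by (rule bexI[OF _ into_three[OF F(1,2) ab(1,2)]]) (use True F(2) ab in \<open>auto simp: four_hom_def\<close>)
  next
    case False
    then obtain x where x: "x \<in> carr A" "x \<in> F" "?n x \<in> F" by blast
    have total: "y \<in> F \<or> ?n y \<in> F" if y: "y \<in> carr A" for y
      using kleeneD[OF A x(1) y] x y F(1) closed n_closed unfolding prime_filter_def by metis
    have n_ab: "(?n a \<in> conjugate F) \<noteq> (?n b \<in> conjugate F)"
      using F(2) ab n_n n_closed by (simp add: conjugate_def)
    have "?n y \<notin> conjugate F" if "y \<in> carr A" "y \<in> conjugate F" for y
      using total[of y] that n_n n_closed by (auto simp: conjugate_def)
    then have "four_hom A (conjugate F) \<in> homs A three"
      using into_three[OF conjugate_prime[OF F(1)] n_ab] n_closed ab by blast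
    moreover have "four_hom A (conjugate F) a \<noteq> four_hom A (conjugate F) b"
      using n_ab ab by (auto simp: four_hom_def)
    ultimately show ?thesis by blast
  qed
qed

lemma valid_kleene_iff:
  assumes "infinite (UNIV :: 'a set)" and "wf_trm s" and "wf_trm t"
  shows "valid (kleene_algebras :: (dm_sym, 'a) alg set) (s, t) \<longleftrightarrow> satisfies three (s, t)"
  using three_mem kleene_separating assms
  unfolding kleene_algebras_def by (intro valid_iff_satisfies) auto

lemma exact_type_kleene:
  assumes inf: "infinite (UNIV :: 'a set)"
  shows "exact_unification_type (kleene_algebras :: (dm_sym, 'a) alg set) = Finitary"
proof (rule exact_type_join_prime[where join = DJoin and one = DOne])
  let ?V = "kleene_algebras :: (dm_sym, 'a) alg set"
  note valid = valid_kleene_iff[OF inf]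
  show "locally_finite ?V"
  proof (rule locally_finiteI[where B = three])
    show "valid ?V (s, t)" if "wf_trm s" "wf_trm t" "satisfies three (s, t)" for s t
      using that by (simp add: valid)
  qed (auto simp: is_alg_three kleene_algebras_def equational_class_def)
  let ?c = "\<lambda>_ :: nat. (False, True)"
  have one: "valid ?V (t, App DOne [])" if t: "wf_trm t" "fst (eval four ?c t)" for t
  proof -
    have "eval three u t = (True, True)" if u: "range u \<subseteq> carr three" for u
    proof -
      have "eval three u t \<in> carr three" by (rule eval_closed[OF is_alg_three t(1)]) (use u in auto)
      then show ?thesis
        using eval_four_information_mono[OF t, of u] by (simp add: eval_three prod_eq_iff)
    qed
    then show ?thesis using t(1) by (simp add: valid satisfies_def)
  qed
  show "valid ?V (s, App DOne []) \<or> valid ?V (t, App DOne [])"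
    if wf: "wf_trm s" "wf_trm t" and st: "valid ?V (App DJoin [s, t], App DOne [])" for s t
  proof -
    have "satisfies three (App DJoin [s, t], App DOne [])"
      using st wf valid[of "App DJoin [s, t]" "App DOne []"] by simp
    then have "eval three ?c (App DJoin [s, t]) = eval three ?c (App DOne [])"
      by (auto simp: satisfies_def)
    then show ?thesis using one wf by (auto simp: eval_three)
  qed
  have "\<not> satisfies three (Var 0, App DOne [])"
  proof
    assume "satisfies three (Var 0, App DOne [])"
    then have "range ?c \<subseteq> carr three \<longrightarrow> eval three ?c (Var 0) = eval three ?c (App DOne [])"
      unfolding satisfies_def fst_conv snd_conv by (rule spec)
    then show False by (auto simp: image_subset_iff)
  qed
  then show "\<not> valid ?V (Var 0, App DOne [])" by (simp add: valid)
qed (auto simp: valid_kleene_iff[OF inf] satisfies_def)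

section \<open>Words modulo idempotency\<close>

text \<open>The free idempotent monoid, as a congruence on words. Nonempty words are congruent only to nonempty
  words, so it also describes the free idempotent semigroup.\<close>

inductive band_eq :: "'x list \<Rightarrow> 'x list \<Rightarrow> bool" (infix "\<approx>" 50) where
  refl: "u \<approx> u"
| sym: "u \<approx> w \<Longrightarrow> w \<approx> u"
| trans: "u \<approx> w \<Longrightarrow> w \<approx> x \<Longrightarrow> u \<approx> x"
| append: "u \<approx> u' \<Longrightarrow> w \<approx> w' \<Longrightarrow> u @ w \<approx> u' @ w'"
| idem: "w @ w \<approx> w"

declare band_eq.trans [trans]

lemma band_eq_context: "u \<approx> w \<Longrightarrow> p @ u @ q \<approx> p @ w @ q"
  by (intro band_eq.append band_eq.refl)

text \<open>With \<open>w = p a q\<close>: from \<open>w a q = p (a q) (a q) = w\<close> it follows that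
  \<open>w a w = (w a) (w a) q = w a q = w\<close>.\<close>

lemma band_eq_absorb_factor: "(p @ a @ q) @ a @ (p @ a @ q) \<approx> p @ a @ q"
proof -
  let ?x = "p @ a @ q"
  have xaq: "?x @ a @ q \<approx> ?x"
    using band_eq_context[OF band_eq.idem[of "a @ q"], of p "[]"] by simp
  have "?x @ a @ ?x \<approx> ?x @ a @ ?x @ a @ q"
    using band_eq_context[OF band_eq.sym[OF xaq], of "?x @ a" "[]"] by simp
  also have "\<dots> \<approx> ?x @ a @ q"
    using band_eq_context[OF band_eq.idem[of "?x @ a"], of "[]" q] by simp
  also note xaq
  finally show ?thesis .
qed

text \<open>The key identity of band theory. For a product \<open>a u\<close>, absorption of the factors \<open>a\<close> and \<open>u\<close> and
  idempotency of \<open>u w a\<close> give \<open>w = w (u w a) w = w (u w a) (u w a) w\<close>. This word has the factor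
  \<open>a u\<close>, which it absorbs by the previous lemma.\<close>

lemma band_eq_absorb:
  assumes "set u \<subseteq> set w"
  shows "w @ u @ w \<approx> w"
  using assms
proof (induction u)
  case Nil
  show ?case using band_eq.idem by simp
next
  case (Cons a u)
  obtain p q where w: "w = p @ [a] @ q" using Cons.prems by (auto simp: in_set_conv_decomp)
  have a: "w @ [a] @ w \<approx> w" using band_eq_absorb_factor[of p "[a]" q] w by simp
  have u: "w @ u @ w \<approx> w" using Cons by simp
  let ?p = "w @ u @ w" and ?q = "w @ [a] @ w"
  have "w \<approx> w @ u @ w" by (rule band_eq.sym[OF u])
  also have "\<dots> \<approx> w @ u @ w @ [a] @ w"
    using band_eq_context[OF band_eq.sym[OF a], of "w @ u" "[]"] by simp
  also have "\<dots> \<approx> w @ (u @ w @ [a]) @ (u @ w @ [a]) @ w"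
    using band_eq_context[OF band_eq.sym[OF band_eq.idem[of "u @ w @ [a]"]], of w w] by simp
  finally have "w \<approx> (w @ u @ w) @ (a # u) @ (w @ [a] @ w)" by simp
  then have w: "w \<approx> ?p @ (a # u) @ ?q" .
  let ?x = "?p @ (a # u) @ ?q"
  have "w @ (a # u) @ w \<approx> ?x @ (a # u) @ ?x"
    using w by (intro band_eq.append band_eq.refl)
  also have "\<dots> \<approx> ?x" by (rule band_eq_absorb_factor)
  also have "\<dots> \<approx> w" by (rule band_eq.sym[OF w])
  finally show ?case .
qed

text \<open>Modulo the congruence, the words with a given set of letters form a rectangular band, so
  \<open>s = e s f = e f\<close>.\<close>

lemma band_eq_rectangular:
  assumes es: "e @ s \<approx> s" and sf: "s @ f \<approx> s" and "set e = set s" and "set f = set s"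
  shows "s \<approx> e @ f"
proof -
  have e: "e \<approx> e @ f @ e" and f: "f \<approx> f @ e @ f"
    using assms by (auto intro!: band_eq.sym[OF band_eq_absorb])
  have c: "(e @ f) @ (e @ s @ f) @ (e @ f) \<approx> e @ f"
    by (rule band_eq_absorb) (use assms in auto)
  have "s \<approx> e @ s" by (rule band_eq.sym[OF es])
  also have "\<dots> \<approx> e @ s @ f" using band_eq_context[OF band_eq.sym[OF sf], of e "[]"] by simp
  also have "\<dots> \<approx> (e @ f @ e) @ s @ (f @ e @ f)" using e f by (intro band_eq.append band_eq.refl)
  also have "\<dots> \<approx> e @ f" using c by simp
  finally show ?thesis .
qed

lemma prefix_up_to_last_new_letter:
  "w \<noteq> [] \<Longrightarrow> \<exists>p a r. w = p @ [a] @ r \<and> a \<notin> set p \<and> set w = insert a (set p)"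
proof (induction w rule: rev_induct)
  case (snoc x w)
  show ?case
  proof (cases "x \<in> set w")
    case True
    then have "w \<noteq> []" by auto
    then obtain p a r where "w = p @ [a] @ r" "a \<notin> set p" "set w = insert a (set p)"
      using snoc.IH by blast
    then have "w @ [x] = p @ [a] @ (r @ [x]) \<and> a \<notin> set p \<and> set (w @ [x]) = insert a (set p)"
      using True by auto
    then show ?thesis by blast
  next
    case False
    then have "w @ [x] = w @ [x] @ [] \<and> x \<notin> set w \<and> set (w @ [x]) = insert x (set w)" by simp
    then show ?thesis by blast
  qed
qed simp

text \<open>The Green--Rees argument. Let \<open>p a\<close> be the shortest prefix of \<open>w\<close> with all letters of \<open>w\<close>, and \<open>b q\<close>
  the shortest such suffix. Then \<open>w\<close> is congruent to \<open>p a b q\<close>, and \<open>p\<close> and \<open>q\<close> range over finitely many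
  classes by induction, since each misses a letter.\<close>

lemma finite_band_words:
  "finite C \<Longrightarrow> \<exists>R. finite R \<and> (\<forall>w. set w \<subseteq> C \<longrightarrow> (\<exists>r\<in>R. w \<approx> r))"
proof (induction C rule: finite_psubset_induct)
  case (psubset C)
  have "\<exists>R. finite R \<and> (\<forall>w. set w \<subseteq> C - {a} \<longrightarrow> (\<exists>r\<in>R. w \<approx> r))" if "a \<in> C" for a
    by (rule psubset.IH) (use that in blast)
  then obtain R where R: "\<And>a. a \<in> C \<Longrightarrow> finite (R a)"
    "\<And>a w. a \<in> C \<Longrightarrow> set w \<subseteq> C - {a} \<Longrightarrow> \<exists>r\<in>R a. w \<approx> r"
    by metis
  define T where "T = insert [] (\<Union>a\<in>C. \<Union>b\<in>C. (\<lambda>(p, q). (p @ [a]) @ ([b] @ q)) ` (R a \<times> R b))"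
  have "finite T" using R(1) psubset.hyps by (auto simp: T_def)
  moreover have "\<exists>r\<in>T. w \<approx> r" if w: "set w \<subseteq> C" for w
  proof (cases "w = []")
    case True
    then show ?thesis by (auto simp: T_def intro: band_eq.refl)
  next
    case False
    obtain p a r where p: "w = p @ [a] @ r" "a \<notin> set p" "set w = insert a (set p)"
      using prefix_up_to_last_new_letter[OF False] by blast
    have "rev w \<noteq> []" using False by simp
    then obtain q b s where q: "rev w = q @ [b] @ s" "b \<notin> set q" "set (rev w) = insert b (set q)"
      using prefix_up_to_last_new_letter by blast
    have q': "w = rev s @ [b] @ rev q" using arg_cong[OF q(1), of rev] by simp
    have set_w: "set (p @ [a]) = set w" "set ([b] @ rev q) = set w" using p(3) q(3) by simp_all
    have w_eq: "w \<approx> (p @ [a]) @ ([b] @ rev q)"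
    proof (rule band_eq_rectangular)
      show "(p @ [a]) @ w \<approx> w"
        using band_eq_context[OF band_eq.idem[of "p @ [a]"], of "[]" r] p(1) by simp
      show "w @ ([b] @ rev q) \<approx> w"
        using band_eq_context[OF band_eq.idem[of "[b] @ rev q"], of "rev s" "[]"] q' by simp
    qed (rule set_w)+
    have ab: "a \<in> C" "b \<in> C" "set p \<subseteq> C - {a}" "set (rev q) \<subseteq> C - {b}"
      using w set_w[symmetric] p(2) q(2) by auto
    obtain p' where p': "p' \<in> R a" "p \<approx> p'" using R(2) ab by blast
    obtain q' where q': "q' \<in> R b" "rev q \<approx> q'" using R(2) ab by blast
    have "(p @ [a]) @ ([b] @ rev q) \<approx> (p' @ [a]) @ ([b] @ q')"
      using p' q' by (intro band_eq.append band_eq.refl)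
    with w_eq have "w \<approx> (p' @ [a]) @ ([b] @ q')" by (rule band_eq.trans)
    moreover have "(p' @ [a]) @ ([b] @ q') \<in> T" 
      unfolding T_def
      by (intro insertI2 UN_I[OF ab(1)] UN_I[OF ab(2)] image_eqI[where x = "(p', q')"]) (use p' q' in auto)
    ultimately show ?thesis by blast
  qed
  ultimately show ?case by blast
qed

section \<open>Idempotent semigroups\<close>

fun letters :: "sg_sym trm \<Rightarrow> nat list" where
  "letters (Var x) = [x]"
| "letters (App f ts) = concat (map letters ts)"

lemma set_letters: "set (letters t) = vars t"
  by (induction t) auto

lemma sg_induct [consumes 1, case_names Var Mult]:
  assumes "wf_trm t" and "\<And>x. P (Var x)"
    and "\<And>s t. wf_trm s \<Longrightarrow> wf_trm t \<Longrightarrow> P s \<Longrightarrow> P t \<Longrightarrow> P (App SMult [s, t])"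
  shows "P t"
  using assms(1)
proof (induction t)
  case (App f ts)
  then obtain s t where "ts = [s, t]" by (cases f) (auto simp: length_2_conv)
  then show ?case using App assms(3) by (cases f) auto
qed (rule assms(2))

lemma letters_nonempty: "wf_trm t \<Longrightarrow> letters t \<noteq> []"
  by (induction rule: sg_induct) auto

text \<open>The value at the empty word is arbitrary: idempotent semigroups need not have a unit, and terms have
  nonempty words of letters.\<close>

fun word_val :: "(sg_sym, 'a) alg \<Rightarrow> (nat \<Rightarrow> 'a) \<Rightarrow> nat list \<Rightarrow> 'a" where
  "word_val A v [] = undefined"
| "word_val A v [x] = v x"
| "word_val A v (x # y # w) = oper A SMult [v x, word_val A v (y # w)]"

lemma idempotent_semigroupD:
  assumes "A \<in> idempotent_semigroups"
  shows "is_alg A"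
    and "x \<in> carr A \<Longrightarrow> y \<in> carr A \<Longrightarrow> z \<in> carr A \<Longrightarrow>
      oper A SMult [x, oper A SMult [y, z]] = oper A SMult [oper A SMult [x, y], z]"
    and "x \<in> carr A \<Longrightarrow> oper A SMult [x, x] = x"
    and "x \<in> carr A \<Longrightarrow> y \<in> carr A \<Longrightarrow> oper A SMult [x, y] \<in> carr A"
proof -
  note A = assms[unfolded idempotent_semigroups_def Let_def]
  show alg: "is_alg A" by (rule equational_classD(1)[OF A])
  show "oper A SMult [x, oper A SMult [y, z]] = oper A SMult [oper A SMult [x, y], z]"
    if "x \<in> carr A" "y \<in> carr A" "z \<in> carr A"
    using satisfiesD3[OF equational_classD(2)[OF A insertI1] that] by simp
  show "oper A SMult [x, x] = x" if "x \<in> carr A"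
    using satisfiesD3[OF equational_classD(2)[OF A insertI2[OF insertI1]] that that that] by simp
  show "oper A SMult [x, y] \<in> carr A" if "x \<in> carr A" "y \<in> carr A"
    using oper_closed[OF alg] that by simp
qed

context
  fixes A :: "(sg_sym, 'a) alg" and v :: "nat \<Rightarrow> 'a"
  assumes A: "A \<in> idempotent_semigroups" and v: "range v \<subseteq> carr A"
begin

lemma word_val_closed: "w \<noteq> [] \<Longrightarrow> word_val A v w \<in> carr A"
proof (induction w rule: induct_list012)
  case (3 x y w)
  then show ?case using v idempotent_semigroupD(4)[OF A] by auto
qed (use v in auto)

lemma word_val_append:
  "u \<noteq> [] \<Longrightarrow> w \<noteq> [] \<Longrightarrow> word_val A v (u @ w) = oper A SMult [word_val A v u, word_val A v w]"
proof (induction u rule: induct_list012)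
  case (2 x)
  then show ?case by (cases w) auto
next
  case (3 x y u)
  then show ?case
    using v word_val_closed idempotent_semigroupD(2)[OF A, of "v x" "word_val A v (y # u)" "word_val A v w"]
    by auto
qed simp

lemma eval_letters: "wf_trm t \<Longrightarrow> eval A v t = word_val A v (letters t)"
  by (induction rule: sg_induct) (auto simp: word_val_append letters_nonempty)

lemma word_val_band_eq:
  "u \<approx> w \<Longrightarrow> (u = [] \<longleftrightarrow> w = []) \<and> word_val A v u = word_val A v w"
proof (induction rule: band_eq.induct)
  case (append u u' w w')
  then show ?case by (cases "u = []"; cases "w = []") (simp_all add: word_val_append)
next
  case (idem w)
  then show ?case
    using word_val_closed idempotent_semigroupD(3)[OF A] by (cases "w = []") (simp_all add: word_val_append)
qed auto

end

lemma valid_idempotent_semigroupsI: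
  assumes "wf_trm s" and "wf_trm t" and "letters s \<approx> letters t"
  shows "valid (idempotent_semigroups :: (sg_sym, 'a) alg set) (s, t)"
  unfolding valid_def satisfies_def fst_conv snd_conv
proof (intro ballI allI impI)
  fix A and v :: "nat \<Rightarrow> 'a" assume A: "A \<in> idempotent_semigroups" "range v \<subseteq> carr A"
  show "eval A v s = eval A v t"
    using word_val_band_eq[OF A assms(3)] eval_letters[OF A] assms(1,2) by simp
qed

lemma locally_finite_idempotent_semigroups:
  "locally_finite (idempotent_semigroups :: (sg_sym, 'a) alg set)"
  unfolding locally_finite_def
proof (intro conjI ballI allI impI)
  fix X :: "nat set" assume "finite X"
  then obtain R where R: "finite R" "\<And>w. set w \<subseteq> X \<Longrightarrow> \<exists>r\<in>R. w \<approx> r"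
    using finite_band_words by blast
  define f where "f t = (SOME r. r \<in> R \<and> letters t \<approx> r)" for t
  have f: "f t \<in> R \<and> letters t \<approx> f t" if "t \<in> carr (Fm X)" for t
  proof -
    have "\<exists>r. r \<in> R \<and> letters t \<approx> r" using R(2)[of "letters t"] that by (auto simp: set_letters)
    then show ?thesis unfolding f_def by (rule someI_ex)
  qed
  show "finite (carr (free_alg (idempotent_semigroups :: (sg_sym, 'a) alg set) X))"
  proof (rule finite_free_algI)
    show "finite (f ` carr (Fm X))" using f by (intro finite_subset[OF _ R(1)] image_subsetI) simp
    fix s t :: "sg_sym trm" assume st: "s \<in> carr (Fm X)" "t \<in> carr (Fm X)" "f s = f t"
    have "letters s \<approx> letters t"
      using f[OF st(1)] f[OF st(2)] st(3) by (auto intro: band_eq.trans band_eq.sym)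
    then show "valid (idempotent_semigroups :: (sg_sym, 'a) alg set) (s, t)"
      using st by (intro valid_idempotent_semigroupsI) auto
  qed
qed (rule idempotent_semigroupD(1))

text \<open>The product keeps first occurrences only. A term in which each variable is valued by itself evaluates
  to its variables in the order of their first occurrences.\<close>

definition order_band :: "(sg_sym, nat list) alg" where
  "order_band = \<lparr>carr = UNIV, oper = (\<lambda>_ as. as ! 0 @ filter (\<lambda>x. x \<notin> set (as ! 0)) (as ! 1))\<rparr>"

lemma order_band_mem: "order_band \<in> idempotent_semigroups"
  by (auto simp: idempotent_semigroups_def equational_class_def is_alg_def satisfies_def order_band_def
      Let_def filter_empty_conv conj_commute intro: filter_cong)

lemma set_eval_order_band:
  "wf_trm t \<Longrightarrow> set (eval order_band (\<lambda>x. [x]) t) = vars t"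
  by (induction rule: sg_induct) (auto simp: order_band_def)

lemma valid_idempotent_semigroups_order:
  assumes "infinite (UNIV :: 'a set)" and "valid (idempotent_semigroups :: (sg_sym, 'a) alg set) (s, t)"
  shows "eval order_band v s = eval order_band v t"
proof -
  have "satisfies order_band (s, t)"
    using assms order_band_mem unfolding idempotent_semigroups_def Let_def
    by (intro valid_imp_satisfies)
  then show ?thesis by (simp add: satisfies_def order_band_def)
qed

text \<open>If \<open>s t \<approx> t s\<close>, the order of first occurrences in the common value starts both with that of \<open>s\<close> and
  with that of \<open>t\<close>, so one of these is a prefix of the other.\<close>

lemma commuting_comparable:
  assumes inf: "infinite (UNIV :: 'a set)" and wf: "wf_trm s" "wf_trm t"
    and comm: "valid (idempotent_semigroups :: (sg_sym, 'a) alg set) (App SMult [s, t], App SMult [t, s])"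
  shows "vars s \<subseteq> vars t \<or> vars t \<subseteq> vars s"
proof -
  let ?o = "eval order_band (\<lambda>x. [x])"
  have "\<exists>u w. ?o s @ u = ?o t @ w"
    using valid_idempotent_semigroups_order[OF inf comm, of "\<lambda>x. [x]"] by (auto simp: order_band_def)
  then have "(\<exists>w. ?o s = ?o t @ w) \<or> (\<exists>w. ?o t = ?o s @ w)"
    unfolding append_eq_append_conv2 by metis
  then have "set (?o s) \<subseteq> set (?o t) \<or> set (?o t) \<subseteq> set (?o s)"
    by (metis set_append Un_upper1)
  then show ?thesis using set_eval_order_band wf by simp
qed

text \<open>Absorption gives \<open>t s t \<approx> t\<close>, and \<open>t s t \<approx> s t t \<approx> s t\<close> by commutation.\<close>

lemma commuting_absorbs:
  fixes V :: "(sg_sym, 'a) alg set"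
  defines "V \<equiv> idempotent_semigroups"
  assumes wf: "wf_trm s" "wf_trm t" and comm: "valid V (App SMult [s, t], App SMult [t, s])"
    and sub: "vars s \<subseteq> vars t"
  shows "valid V (App SMult [s, t], t)"
  unfolding valid_def satisfies_def fst_conv snd_conv
proof (intro ballI allI impI)
  fix A and v :: "nat \<Rightarrow> 'a" assume A: "A \<in> V" and v: "range v \<subseteq> carr A"
  let ?m = "\<lambda>x y. oper A SMult [x, y]" and ?s = "eval A v s" and ?t = "eval A v t"
  note band = idempotent_semigroupD[OF A[unfolded V_def]]
  have mem: "?s \<in> carr A" "?t \<in> carr A" by (rule eval_closed[OF band(1)]; use wf v in auto)+
  have "letters (App SMult [App SMult [t, s], t]) \<approx> letters t"
    using band_eq_absorb[of "letters s" "letters t"] sub by (simp add: set_letters)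
  then have "valid V (App SMult [App SMult [t, s], t], t)"
    unfolding V_def using wf by (intro valid_idempotent_semigroupsI) auto
  then have tst: "?m (?m ?t ?s) ?t = ?t" using validD[OF _ A v] by fastforce
  have st: "?m ?s ?t = ?m ?t ?s" using validD[OF comm A v] by simp
  have "?m (?m ?s ?t) ?t = ?m ?s ?t" using band(2)[OF mem mem(2)] band(3)[OF mem(2)] by simp
  then show "eval A v (App SMult [s, t]) = eval A v t" using st tst by simp
qed

text \<open>Commuting terms of the free band are comparable, so a unifier of \<open>x y \<approx> y x\<close> satisfies \<open>x y \<approx> y\<close> or
  \<open>y x \<approx> x\<close>. The unifiers \<open>(a, a b a)\<close> and \<open>(a b a, a)\<close> violate one of these each.\<close>

lemma exact_type_idempotent_semigroups:
  assumes inf: "infinite (UNIV :: 'a set)"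
  shows "exact_unification_type (idempotent_semigroups :: (sg_sym, 'a) alg set) = Finitary"
proof -
  let ?V = "idempotent_semigroups :: (sg_sym, 'a) alg set"
  define m :: "sg_sym trm \<Rightarrow> sg_sym trm \<Rightarrow> sg_sym trm" where "m s t = App SMult [s, t]" for s t
  define S where "S = {(m (Var 0) (Var 1), m (Var 1) (Var 0))}"
  define aba where "aba = m (Var 0) (m (Var 1) (Var 0))"
  define g1 g2 where "g1 x = (if x = 0 then Var 0 else aba)" and "g2 x = (if x = 0 then aba else Var 0)" for x :: nat
  have X: "identity_vars S = {0, 1}" by (auto simp: S_def identity_vars_def m_def)
  have sub: "subst_of {0, 1} g1 \<in> substs {0, 1}" "subst_of {0, 1} g2 \<in> substs {0, 1}"
    by (rule subst_of_substs; simp add: g1_def g2_def aba_def m_def)+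
  have app: "\<sigma> (m (Var x) (Var y)) = m (\<sigma> (Var x)) (\<sigma> (Var y))"
    if "\<sigma> \<in> substs {0, 1}" "x \<in> {0, 1}" "y \<in> {0, 1}" for \<sigma> x y
    unfolding m_def using subst_App[OF that(1)] that(2,3) by simp
  have unif: "\<sigma> \<in> unifiers ?V {0, 1} S \<longleftrightarrow> \<sigma> \<in> substs {0, 1} \<and>
      valid ?V (m (\<sigma> (Var 0)) (\<sigma> (Var 1)), m (\<sigma> (Var 1)) (\<sigma> (Var 0)))" for \<sigma>
    by (auto simp: unifiers_def S_def app simp del: One_nat_def)
  have aba: "valid ?V (m (Var 0) aba, m aba (Var 0))"
  proof (rule valid_idempotent_semigroupsI)
    have "[0::nat] @ [0, 1, 0] \<approx> [0, 1, 0]"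
      using band_eq_context[OF band_eq.idem[of "[0::nat]"], of "[]" "[1, 0]"] by simp
    also have "[0::nat, 1, 0] \<approx> [0, 1, 0] @ [0]"
      using band_eq_context[OF band_eq.sym[OF band_eq.idem[of "[0::nat]"]], of "[0, 1]" "[]"] by simp
    finally show "letters (m (Var 0) aba) \<approx> letters (m aba (Var 0))" by (simp add: m_def aba_def)
  qed (simp_all add: m_def aba_def)
  have no: "\<not> valid ?V (m aba (Var 0), Var 0)"
  proof
    assume "valid ?V (m aba (Var 0), Var 0)"
    from valid_idempotent_semigroups_order[OF inf this, of "\<lambda>x. [x]"] show False
      by (simp add: m_def aba_def order_band_def)
  qed
  show ?thesis
  proof (rule exact_unification_type_finitaryI[OF locally_finite_idempotent_semigroups, where S = S])
    show "S \<subseteq> carr (Fm UNIV) \<times> carr (Fm UNIV)" "finite S" by (auto simp: S_def m_def)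
    show "m (Var 0) (Var 1) \<in> carr (Fm (identity_vars S))" "Var 1 \<in> carr (Fm (identity_vars S))"
      "m (Var 1) (Var 0) \<in> carr (Fm (identity_vars S))" "Var 0 \<in> carr (Fm (identity_vars S))"
      using X by (auto simp: m_def)
    show "valid ?V (\<sigma> (m (Var 0) (Var 1)), \<sigma> (Var 1)) \<or> valid ?V (\<sigma> (m (Var 1) (Var 0)), \<sigma> (Var 0))"
      if "\<sigma> \<in> unifiers ?V (identity_vars S) S" for \<sigma>
    proof -
      have \<sigma>: "\<sigma> \<in> substs {0, 1}" "valid ?V (m (\<sigma> (Var 0)) (\<sigma> (Var 1)), m (\<sigma> (Var 1)) (\<sigma> (Var 0)))"
        using that unfolding X unif by auto
      have wf: "wf_trm (\<sigma> (Var 0))" "wf_trm (\<sigma> (Var 1))" using subst_closed[OF \<sigma>(1)] by simp_all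
      show ?thesis
        using commuting_comparable[OF inf wf] commuting_absorbs[OF wf] commuting_absorbs[OF wf(2,1)]
          \<sigma>(2) valid_sym[OF \<sigma>(2)] app[OF \<sigma>(1)] unfolding m_def by auto
    qed
    show "subst_of {0, 1} g2 \<in> unifiers ?V (identity_vars S) S"
      "subst_of {0, 1} g1 \<in> unifiers ?V (identity_vars S) S"
      unfolding X unif using sub aba valid_sym[OF aba] by (simp_all add: g1_def g2_def)
    show "\<not> valid ?V (subst_of {0, 1} g2 (m (Var 0) (Var 1)), subst_of {0, 1} g2 (Var 1))"
      "\<not> valid ?V (subst_of {0, 1} g1 (m (Var 1) (Var 0)), subst_of {0, 1} g1 (Var 0))"
      using sub no by (simp_all add: app g1_def g2_def del: One_nat_def)
  qed
qed

section \<open>The exact unification types\<close>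

theorem mainTheorem3:
  assumes "infinite (UNIV :: 'a set)"
  shows "exact_unification_type (distributive_lattices :: (lat_sym, 'a) alg set) = Unitary \<and>
    exact_unification_type (bounded_distributive_lattices :: (blat_sym, 'a) alg set) = Finitary \<and>
    exact_unification_type (idempotent_semigroups :: (sg_sym, 'a) alg set) = Finitary \<and>
    exact_unification_type (de_morgan_algebras :: (dm_sym, 'a) alg set) = Finitary \<and>
    exact_unification_type (kleene_algebras :: (dm_sym, 'a) alg set) = Finitary"
  using exact_type_distributive_lattices[OF assms] exact_type_bounded_distributive_lattices[OF assms]
    exact_type_idempotent_semigroups[OF assms] exact_type_de_morgan[OF assms] exact_type_kleene[OF assms]
  by (intro conjI)

end
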